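(* Let $K$ be an oriented knot in $S^3$ with knot group $G(K)$, let $G$ be a finite group with regular representation $\rho\colon G\to \mathrm{GL}(|G|,\mathbb{Z})$, and let $H\subset G$ be a normal subgroup of order $p^n$ for a prime number $p$ (with $n\ge 0$ an integer). Then for every epimorphism $f\colon G(K)\to G$ we have $$\Delta_K^{\rho\circ f}(t)\equiv\left(\Delta_K^{\tilde\rho\circ f}(t)\right)^{p^n}\pmod p,$$ where $\tilde\rho=\rho_{H\backslash G}\circ\pi$ is the composition of the quotient map $\pi\colon G\to H\backslash G$ and the regular representation $\rho_{H\backslash G}\colon H\backslash G\to\mathrm{GL}(|H\backslash G|,\mathbb{Z})$ of the quotient group $H\backslash G$.
   Context: Knot group: for an oriented knot $K\subset S^3$, $E_K=S^3\setminus\nu(K)$ is the complement of an open tubular neighborhood and $G(K)=\pi_1(E_K)$. Let $\phi\colon G(K)\to\mathbb{Z}=\langle t\rangle$ be the abelianization, sending an oriented meridian to $t$. Twisted Alexander polynomial (Wada): let $R$ be a Noetherian unique factorization domain with quotient field $Q$ and $\varrho\colon G(K)\to\mathrm{GL}(k,R)$ a representation. Fix a Wirtinger presentation $G(K)=\langle s_1,\dots,s_m\mid r_1,\dots,r_{m-1}\rangle$. Extend $s\mapsto\phi(s)\varrho(s)$ to a ring homomorphism $\mathbb{Z}[G(K)]\to\mathrm{Mat}(k,R[t^{\pm1}])$, and let $\Phi\colon\mathbb{Z}[F_m]\to\mathrm{Mat}(k,R[t^{\pm1}])$ be its composition with the surjection $\mathbb{Z}[F_m]\to\mathbb{Z}[G(K)]$,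 where $F_m=\langle s_1,\dots,s_m\rangle$ is free. Let $M$ be the $k(m-1)\times km$ matrix with blocks $\Phi(\partial r_i/\partial s_j)$ (Fox derivatives), and let $M_j$ be $M$ with the $j$-th block column removed. Then $$\Delta_K^{\varrho}(t)=\frac{\det M_j}{\det\Phi(s_j-1)}\in Q(t),$$ which is well defined up to multiplication by $\varepsilon t^l$ ($\varepsilon\in R^\times$, $l\in\mathbb{Z}$). Regular representation: for a finite group $G$, $\rho\colon G\to\mathrm{Aut}_{\mathbb{Z}}(\mathbb{Z}[G])\cong\mathrm{GL}(|G|,\mathbb{Z})$ is the permutation representation given by the action of $G$ on itself by right multiplication (matrices acting on row vectors). "mod $p$" means reduction modulo $p$ of each integer coefficient (of the numerator and of the denominator of the Wada expression), so the congruence is an equality in $\mathbb{F}_p(t)$; as usual, it is understood up to multiplication by units $\varepsilon t^l$ ($\varepsilon\in\mathbb{F}_p^\times$, $l\in\mathbb{Z}$). *)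

theory Defs
  imports
    "HOL-Analysis.Analysis"
    "HOL-Algebra.Generated_Groups"
    "HOL-Algebra.Elementary_Groups"
    "HOL-Library.Poly_Mapping"
    "HOL-Computational_Algebra.Fraction_Field"
    "Jordan_Normal_Form.Determinant"
    "Berlekamp_Zassenhaus.Finite_Field"
begin

section \<open>Smooth oriented knots in the 3-sphere\<close>

primrec Ck_on :: "nat \<Rightarrow> ('a::euclidean_space \<Rightarrow> 'b::real_normed_vector) \<Rightarrow> 'a set \<Rightarrow> bool" where
  "Ck_on 0 = (\<lambda>f S. continuous_on S f)"
| "Ck_on (Suc k) = (\<lambda>f S. \<exists>f'. (\<forall>x\<in>S. (f has_derivative f' x) (at x))
                            \<and> (\<forall>v. Ck_on k (\<lambda>x. f' x v) S))"

text \<open>To be used on open sets only.\<close>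
definition smooth_on :: "'a::euclidean_space set \<Rightarrow> ('a \<Rightarrow> 'b::real_normed_vector) \<Rightarrow> bool" where
  "smooth_on S f \<longleftrightarrow> (\<forall>k. Ck_on k f S)"

abbreviation S3 :: "(real^4) set" where
  "S3 \<equiv> sphere 0 1"

text \<open>An oriented knot is given by a smooth 1-periodic regular parametrization; the knot is
  the range of \<^term>\<open>c\<close>, oriented in the direction of increasing parameter.\<close>
definition oriented_knot :: "(real \<Rightarrow> real^4) \<Rightarrow> bool" where
  "oriented_knot c \<longleftrightarrow>
     smooth_on UNIV c \<and> range c \<subseteq> S3 \<and> (\<forall>s. c (s + 1) = c s) \<and> inj_on c {0..<1} \<and>
     (\<forall>s. vector_derivative c (at s) \<noteq> 0)"

text \<open>A tubular neighborhood is a smooth, orientation preserving embedding of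
  $S^1 \times \{|w| < 2\}$ into $S^3$, 1-periodic in the $S^1$ variable, with core the given
  parametrized knot; the open tubular neighborhood $\nu(K)$ is the image of the part $|w| < 1$,
  so that its closure is a smooth solid torus.  The tangent frame $v_1, v_2, v_3$ at $x \in S^3$
  is positive iff $\det(x, v_1, v_2, v_3) > 0$ (outward normal first).  Positivity of
  the determinant includes that the map is an immersion, and fixes the sense of rotation of
  the meridian circles below.\<close>
definition tubular_neighborhood :: "(real \<Rightarrow> real^4) \<Rightarrow> (real \<times> complex \<Rightarrow> real^4) \<Rightarrow> bool" where
  "tubular_neighborhood c \<tau> \<longleftrightarrow>
     smooth_on (UNIV \<times> ball 0 2) \<tau> \<and> \<tau> ` (UNIV \<times> ball 0 2) \<subseteq> S3 \<and>
     (\<forall>s. \<forall>w\<in>ball 0 2. \<tau> (s + 1, w) = \<tau> (s, w)) \<and>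
     inj_on \<tau> ({0..<1} \<times> ball 0 2) \<and>
     (\<forall>s. \<tau> (s, 0) = c s) \<and>
     (\<forall>s. \<forall>w\<in>ball 0 2. let D = frechet_derivative \<tau> (at (s, w)) in
        Determinants.det (vector [\<tau> (s, w), D (1, 0), D (0, 1), D (0, \<i>)] :: real^4^4) > 0)"

definition knot_exterior :: "(real \<times> complex \<Rightarrow> real^4) \<Rightarrow> (real^4) set" where
  "knot_exterior \<tau> = S3 - \<tau> ` (UNIV \<times> ball 0 1)"

section \<open>The fundamental group\<close>

definition path_class :: "'a::real_normed_vector set \<Rightarrow> (real \<Rightarrow> 'a) \<Rightarrow> (real \<Rightarrow> 'a) set" where
  "path_class S p = {q. homotopic_paths S p q}"

definition loops_at :: "'a::real_normed_vector set \<Rightarrow> 'a \<Rightarrow> (real \<Rightarrow> 'a) set" where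
  "loops_at S x = {p. path p \<and> path_image p \<subseteq> S \<and> pathstart p = x \<and> pathfinish p = x}"

definition fundamental_group :: "'a::real_normed_vector set \<Rightarrow> 'a \<Rightarrow> (real \<Rightarrow> 'a) set monoid" where
  "fundamental_group S x =
     \<lparr>carrier = path_class S ` loops_at S x,
      mult = (\<lambda>A B. \<Union>p\<in>A. \<Union>q\<in>B. path_class S (p +++ q)),
      one = path_class S (linepath x x)\<rparr>"

lemma path_class_eq_iff:
  assumes "p \<in> loops_at S x"
  shows "path_class S p = path_class S q \<longleftrightarrow> homotopic_paths S p q"
proof
  assume eq: "path_class S p = path_class S q"
  have "p \<in> path_class S p"
    using assms by (simp add: path_class_def loops_at_def)
  then have "homotopic_paths S q p"
    unfolding eq by (simp add: path_class_def)
  then show "homotopic_paths S p q"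
    by (rule homotopic_paths_sym)
next
  assume pq: "homotopic_paths S p q"
  show "path_class S p = path_class S q"
    unfolding path_class_def
    using homotopic_paths_trans[OF pq] homotopic_paths_trans[OF homotopic_paths_sym[OF pq]]
    by (intro Collect_cong iffI)
qed

lemma path_class_self: "p \<in> loops_at S x \<Longrightarrow> p \<in> path_class S p"
  by (simp add: path_class_def loops_at_def)

lemma path_class_join:
  assumes "p \<in> loops_at S x" "q \<in> loops_at S x"
  shows "path_class S p \<otimes>\<^bsub>fundamental_group S x\<^esub> path_class S q = path_class S (p +++ q)"
proof -
  have "path_class S (p' +++ q') = path_class S (p +++ q)"
    if "p' \<in> path_class S p" "q' \<in> path_class S q" for p' q'
  proof -
    have "homotopic_paths S (p +++ q) (p' +++ q')"
      using that assms unfolding path_class_def loops_at_def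
      by (intro homotopic_paths_join) auto
    moreover have "p +++ q \<in> loops_at S x"
      using assms by (auto simp: loops_at_def path_image_join)
    ultimately show ?thesis
      using path_class_eq_iff by metis
  qed
  then have "(\<Union>p'\<in>path_class S p. \<Union>q'\<in>path_class S q. path_class S (p' +++ q'))
      = path_class S (p +++ q)"
    using path_class_self[OF assms(1)] path_class_self[OF assms(2)] by fast
  then show ?thesis
    by (simp add: fundamental_group_def)
qed

lemma group_fundamental_group:
  assumes "x \<in> S"
  shows "group (fundamental_group S x)"
proof -
  let ?G = "fundamental_group S x"
  have carr: "carrier ?G = path_class S ` loops_at S x"
    and one: "\<one>\<^bsub>?G\<^esub> = path_class S (linepath x x)"
    by (simp_all add: fundamental_group_def)
  have lp: "linepath x x \<in> loops_at S x"
    using assms by (simp add: loops_at_def)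
  have jn: "p +++ q \<in> loops_at S x" if "p \<in> loops_at S x" "q \<in> loops_at S x" for p q
    using that by (auto simp: loops_at_def path_image_join)
  have rv: "reversepath p \<in> loops_at S x" if "p \<in> loops_at S x" for p
    using that by (auto simp: loops_at_def)
  show ?thesis
  proof (rule groupI)
    fix A B assume "A \<in> carrier ?G" "B \<in> carrier ?G"
    then show "A \<otimes>\<^bsub>?G\<^esub> B \<in> carrier ?G"
      unfolding carr by (auto simp: path_class_join jn)
  next
    show "\<one>\<^bsub>?G\<^esub> \<in> carrier ?G"
      unfolding carr one using lp by blast
  next
    fix A B C assume "A \<in> carrier ?G" "B \<in> carrier ?G" "C \<in> carrier ?G"
    then obtain p q r where *: "p \<in> loops_at S x" "q \<in> loops_at S x" "r \<in> loops_at S x"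
      and eq: "A = path_class S p" "B = path_class S q" "C = path_class S r"
      unfolding carr by blast
    have "homotopic_paths S ((p +++ q) +++ r) (p +++ (q +++ r))"
      using * unfolding loops_at_def
      by (intro homotopic_paths_sym[OF homotopic_paths_assoc]) auto
    then have "path_class S ((p +++ q) +++ r) = path_class S (p +++ (q +++ r))"
      using path_class_eq_iff[OF jn[OF jn[OF *(1,2)] *(3)]] by simp
    then show "A \<otimes>\<^bsub>?G\<^esub> B \<otimes>\<^bsub>?G\<^esub> C = A \<otimes>\<^bsub>?G\<^esub> (B \<otimes>\<^bsub>?G\<^esub> C)"
      by (simp add: eq path_class_join jn *)
  next
    fix A assume "A \<in> carrier ?G"
    then obtain p where p: "p \<in> loops_at S x" and A: "A = path_class S p"
      unfolding carr by blast
    have "homotopic_paths S (linepath x x +++ p) p"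
      using p homotopic_paths_lid[of p S] by (auto simp: loops_at_def)
    then show "\<one>\<^bsub>?G\<^esub> \<otimes>\<^bsub>?G\<^esub> A = A"
      by (simp add: A one path_class_join lp p path_class_eq_iff[OF jn[OF lp p]])
    have "homotopic_paths S (reversepath p +++ p) (linepath x x)"
      using p homotopic_paths_linv[of p S] by (auto simp: loops_at_def)
    then have "path_class S (reversepath p) \<otimes>\<^bsub>?G\<^esub> A = \<one>\<^bsub>?G\<^esub>"
      by (simp add: A one path_class_join rv p path_class_eq_iff[OF jn[OF rv[OF p] p]])
    then show "\<exists>B\<in>carrier ?G. B \<otimes>\<^bsub>?G\<^esub> A = \<one>\<^bsub>?G\<^esub>"
      unfolding carr using rv[OF p] by blast
  qed
qed

section \<open>The knot group, its abelianization and its Wirtinger presentations\<close>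

abbreviation knot_group :: "(real \<times> complex \<Rightarrow> real^4) \<Rightarrow> real^4 \<Rightarrow> (real \<Rightarrow> real^4) set monoid" where
  "knot_group \<tau> x \<equiv> fundamental_group (knot_exterior \<tau>) x"

text \<open>The fibre circle of the boundary torus over the parameter \<^term>\<open>s\<close>; by the orientation
  convention for \<^term>\<open>\<tau>\<close> it has linking number $+1$ with the knot.\<close>
definition meridian_circle :: "(real \<times> complex \<Rightarrow> real^4) \<Rightarrow> real \<Rightarrow> real \<Rightarrow> real^4" where
  "meridian_circle \<tau> s = (\<lambda>\<theta>. \<tau> (s, cis (2 * pi * \<theta>)))"

definition oriented_meridians :: "(real \<times> complex \<Rightarrow> real^4) \<Rightarrow> real^4 \<Rightarrow> (real \<Rightarrow> real^4) set set" where
  "oriented_meridians \<tau> x =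
     {path_class (knot_exterior \<tau>) (\<alpha> +++ (meridian_circle \<tau> s +++ reversepath \<alpha>)) | \<alpha> s.
        path \<alpha> \<and> path_image \<alpha> \<subseteq> knot_exterior \<tau> \<and> pathstart \<alpha> = x \<and> pathfinish \<alpha> = \<tau> (s, 1)}"

text \<open>The infinite cyclic group generated by $t$ is written additively: $t^l$ is the integer $l$.\<close>
definition knot_abelianization ::
    "(real \<times> complex \<Rightarrow> real^4) \<Rightarrow> real^4 \<Rightarrow> ((real \<Rightarrow> real^4) set \<Rightarrow> int) \<Rightarrow> bool" where
  "knot_abelianization \<tau> x \<phi> \<longleftrightarrow>
     \<phi> \<in> epi (knot_group \<tau> x) integer_group \<and>
     kernel (knot_group \<tau> x) integer_group \<phi> = derived (knot_group \<tau> x) (carrier (knot_group \<tau> x)) \<and>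
     (\<forall>\<mu>\<in>oriented_meridians \<tau> x. \<phi> \<mu> = 1)"

text \<open>Words in the letters $s_0, \dots, s_{m-1}$ (the letter $(i, True)$) and their inverses
  ($(i, False)$) represent the elements of the free group $F_m$.\<close>
type_synonym word = "(nat \<times> bool) list"

definition words :: "nat \<Rightarrow> word set" where
  "words m = lists ({..<m} \<times> UNIV)"

definition letter_eval :: "('g, 'x) monoid_scheme \<Rightarrow> 'g list \<Rightarrow> nat \<times> bool \<Rightarrow> 'g" where
  "letter_eval G gens l = (if snd l then gens ! fst l else inv\<^bsub>G\<^esub> (gens ! fst l))"

definition word_eval :: "('g, 'x) monoid_scheme \<Rightarrow> 'g list \<Rightarrow> word \<Rightarrow> 'g" where
  "word_eval G gens w = foldr (\<lambda>l g. letter_eval G gens l \<otimes>\<^bsub>G\<^esub> g) w \<one>\<^bsub>G\<^esub>"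

text \<open>Equality in the group presented with relator set \<^term>\<open>R\<close>.  A word is related to the empty
  word iff it represents an element of the normal closure of \<^term>\<open>R\<close> in the free group.\<close>
inductive pres_eq :: "word set \<Rightarrow> word \<Rightarrow> word \<Rightarrow> bool" for R where
  refl: "pres_eq R u u"
| sym: "pres_eq R u v \<Longrightarrow> pres_eq R v u"
| trans: "pres_eq R u v \<Longrightarrow> pres_eq R v w \<Longrightarrow> pres_eq R u w"
| cancel: "pres_eq R (u @ [(i, e), (i, \<not> e)] @ v) (u @ v)"
| relator: "r \<in> R \<Longrightarrow> pres_eq R (u @ r @ v) (u @ v)"

definition is_presentation :: "('g, 'x) monoid_scheme \<Rightarrow> 'g list \<Rightarrow> word list \<Rightarrow> bool" where
  "is_presentation G gens rels \<longleftrightarrow>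
     set gens \<subseteq> carrier G \<and> set rels \<subseteq> words (length gens) \<and>
     (\<forall>g\<in>carrier G. \<exists>w\<in>words (length gens). word_eval G gens w = g) \<and>
     (\<forall>w\<in>words (length gens). word_eval G gens w = \<one>\<^bsub>G\<^esub> \<longleftrightarrow> pres_eq (set rels) w [])"

text \<open>The relator $s_a s_b s_a^{-1} s_c^{-1}$.  With $a$ the overcrossing arc, it covers
  crossings of both signs, by exchanging the roles of $b$ and $c$.\<close>
definition wirtinger_relator :: "nat \<Rightarrow> nat \<Rightarrow> nat \<Rightarrow> word" where
  "wirtinger_relator a b c = [(a, True), (b, True), (a, False), (c, False)]"

text \<open>A Wirtinger presentation $\langle s_1,\dots,s_m \mid r_1,\dots,r_{m-1}\rangle$: the generators
  are oriented meridians, and every relator is a Wirtinger relator.  The presentations read off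
  from the regular diagrams of the knot, with one relator omitted, are of this form.\<close>
definition wirtinger_presentation ::
    "(real \<times> complex \<Rightarrow> real^4) \<Rightarrow> real^4 \<Rightarrow> (real \<Rightarrow> real^4) set list \<Rightarrow> word list \<Rightarrow> bool" where
  "wirtinger_presentation \<tau> x gens rels \<longleftrightarrow>
     is_presentation (knot_group \<tau> x) gens rels \<and>
     length gens = length rels + 1 \<and>
     set gens \<subseteq> oriented_meridians \<tau> x \<and>
     (\<forall>r\<in>set rels. \<exists>a b c. r = wirtinger_relator a b c)"

section \<open>Laurent polynomials and reduction modulo a prime\<close>

text \<open>The ring $R[t^{\pm 1}]$; its fraction field is $Q(t)$, where $Q$ is the quotient field
  of the integral domain $R$.\<close>
type_synonym 'r laurent = "int \<Rightarrow>\<^sub>0 'r"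

abbreviation laurent_monom :: "'r::zero \<Rightarrow> int \<Rightarrow> 'r laurent" where
  "laurent_monom a l \<equiv> Poly_Mapping.single l a"

definition laurent_mod :: "int laurent \<Rightarrow> 'p::prime_card mod_ring laurent" where
  "laurent_mod f = Poly_Mapping.map of_int f"

text \<open>Reduction of the coefficients of numerator and denominator.  It is defined on those
  fractions that can be written with a denominator that does not vanish modulo $p$, and
  then does not depend on the choice of such a representation, see the lemma
  \<open>fract_mod_Fract\<close>.\<close>
definition fract_mod :: "int laurent fract \<Rightarrow> 'p::prime_card mod_ring laurent fract" where
  "fract_mod x = (THE y. \<exists>a b. laurent_mod b \<noteq> (0 :: 'p mod_ring laurent) \<and>
     x = Fract a b \<and> y = Fract (laurent_mod a) (laurent_mod b))"

lemma lookup_laurent_mod: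
  "Poly_Mapping.lookup (laurent_mod f :: 'p::prime_card mod_ring laurent) l
     = of_int (Poly_Mapping.lookup f l)"
  by (simp add: laurent_mod_def Poly_Mapping.map.rep_eq when_def)

lemma laurent_mod_add:
  "(laurent_mod (f + g) :: 'p::prime_card mod_ring laurent) = laurent_mod f + laurent_mod g"
  by (rule poly_mapping_eqI) (simp add: lookup_laurent_mod lookup_add)

lemma laurent_mod_0: "(laurent_mod 0 :: 'p::prime_card mod_ring laurent) = 0"
  by (rule poly_mapping_eqI) (simp add: lookup_laurent_mod)

lemma laurent_mod_single:
  "(laurent_mod (laurent_monom a l) :: 'p::prime_card mod_ring laurent) = laurent_monom (of_int a) l"
  by (rule poly_mapping_eqI) (simp add: lookup_laurent_mod lookup_single when_def)

lemma laurent_mod_sum: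
  "(laurent_mod (sum h A) :: 'p::prime_card mod_ring laurent) = (\<Sum>a\<in>A. laurent_mod (h a))"
  by (induction A rule: infinite_finite_induct) (auto simp: laurent_mod_0 laurent_mod_add)

lemma laurent_sum_monoms:
  "(\<Sum>k\<in>Poly_Mapping.keys f. laurent_monom (Poly_Mapping.lookup f k) k) = f"
  by (rule poly_mapping_eqI) (auto simp: lookup_sum lookup_single when_def in_keys_iff)

lemma laurent_mod_mult:
  "(laurent_mod (f * g) :: 'p::prime_card mod_ring laurent) = laurent_mod f * laurent_mod g"
proof -
  have "f = (\<Sum>k\<in>Poly_Mapping.keys f. laurent_monom (Poly_Mapping.lookup f k) k)" (is "_ = ?f")
    "g = (\<Sum>k\<in>Poly_Mapping.keys g. laurent_monom (Poly_Mapping.lookup g k) k)" (is "_ = ?g")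
    by (simp_all only: laurent_sum_monoms)
  moreover have "laurent_mod (?f * ?g) = (laurent_mod ?f * laurent_mod ?g :: 'p mod_ring laurent)"
    by (simp add: sum_product laurent_mod_sum mult_single laurent_mod_single)
  ultimately show ?thesis
    by simp
qed

lemma fract_mod_Fract:
  assumes "laurent_mod b \<noteq> (0 :: 'p::prime_card mod_ring laurent)"
  shows "fract_mod (Fract a b) = (Fract (laurent_mod a) (laurent_mod b) :: 'p mod_ring laurent fract)"
  unfolding fract_mod_def
proof (rule the_equality)
  show "\<exists>a' b'. laurent_mod b' \<noteq> (0 :: 'p mod_ring laurent) \<and> Fract a b = Fract a' b' \<and>
      (Fract (laurent_mod a) (laurent_mod b) :: 'p mod_ring laurent fract)
        = Fract (laurent_mod a') (laurent_mod b')"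
    using assms by blast
next
  fix y :: "'p mod_ring laurent fract"
  assume "\<exists>a' b'. laurent_mod b' \<noteq> (0 :: 'p mod_ring laurent) \<and> Fract a b = Fract a' b' \<and>
      y = Fract (laurent_mod a') (laurent_mod b')"
  then obtain a' b' where *: "laurent_mod b' \<noteq> (0 :: 'p mod_ring laurent)"
      "Fract a b = Fract a' b'" "y = Fract (laurent_mod a') (laurent_mod b')"
    by blast
  have "b \<noteq> 0" "b' \<noteq> 0"
    using assms * by (auto simp: laurent_mod_0)
  then have "a * b' = a' * b"
    using *(2) by (simp add: eq_fract)
  then have "laurent_mod a * laurent_mod b' = (laurent_mod a' * laurent_mod b :: 'p mod_ring laurent)"
    by (simp flip: laurent_mod_mult)
  then show "y = Fract (laurent_mod a) (laurent_mod b)"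
    using * assms by (simp add: eq_fract)
qed

definition eq_up_to_unit :: "'k::field laurent fract \<Rightarrow> 'k laurent fract \<Rightarrow> bool" where
  "eq_up_to_unit x y \<longleftrightarrow> (\<exists>\<epsilon> l. \<epsilon> \<noteq> 0 \<and> x = Fract (laurent_monom \<epsilon> l) 1 * y)"

section \<open>The twisted Alexander polynomial\<close>

text \<open>Elements of $\mathbb{Z}[F_m]$ are represented by formal integer combinations of words.
  This is a faithful way to evaluate them, since \<open>Phi_word\<close> below is invariant under free
  reduction of words, and Fox differentiation is invariant up to free reduction.\<close>

definition left_mult :: "word \<Rightarrow> (word \<Rightarrow>\<^sub>0 int) \<Rightarrow> (word \<Rightarrow>\<^sub>0 int)" where
  "left_mult u = frag_extend (\<lambda>v. frag_of (u @ v))"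

text \<open>The Fox derivative $\partial/\partial s_j$, from $\partial(uv) = \partial u + u\,\partial v$,
  $\partial s_i/\partial s_j = \delta_{ij}$ and
  $\partial s_i^{-1}/\partial s_j = -\delta_{ij} s_i^{-1}$.\<close>
fun fox :: "nat \<Rightarrow> word \<Rightarrow> (word \<Rightarrow>\<^sub>0 int)" where
  "fox j [] = 0"
| "fox j ((i, e) # w) =
     (if i = j then (if e then frag_of [] else - frag_of [(i, False)]) else 0)
     + left_mult [(i, e)] (fox j w)"

text \<open>In the following definitions \<^term>\<open>\<phi>\<close> is the abelianization of the presented group
  \<^term>\<open>GK\<close>, and \<^term>\<open>\<rho>\<close> is a representation of \<^term>\<open>GK\<close> by $k \times k$ matrices over
  an integral domain.\<close>

definition Phi_word ::
    "('g, 'x) monoid_scheme \<Rightarrow> ('g \<Rightarrow> int) \<Rightarrow> 'g list \<Rightarrow> ('g \<Rightarrow> 'r::idom mat) \<Rightarrow> word \<Rightarrow> 'r laurent mat" where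
  "Phi_word GK \<phi> gens \<rho> w =
     (let g = word_eval GK gens w in map_mat (\<lambda>a. laurent_monom a (\<phi> g)) (\<rho> g))"

definition Phi ::
    "('g, 'x) monoid_scheme \<Rightarrow> ('g \<Rightarrow> int) \<Rightarrow> 'g list \<Rightarrow> nat \<Rightarrow> ('g \<Rightarrow> 'r::idom mat)
      \<Rightarrow> (word \<Rightarrow>\<^sub>0 int) \<Rightarrow> 'r laurent mat" where
  "Phi GK \<phi> gens k \<rho> z = mat k k (\<lambda>(a, b).
     \<Sum>w\<in>Poly_Mapping.keys z. of_int (Poly_Mapping.lookup z w) * Phi_word GK \<phi> gens \<rho> w $$ (a, b))"

definition fox_matrix ::
    "('g, 'x) monoid_scheme \<Rightarrow> ('g \<Rightarrow> int) \<Rightarrow> 'g list \<Rightarrow> word list \<Rightarrow> nat \<Rightarrow> ('g \<Rightarrow> 'r::idom mat)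
      \<Rightarrow> 'r laurent mat" where
  "fox_matrix GK \<phi> gens rels k \<rho> = mat (k * length rels) (k * length gens) (\<lambda>(a, b).
     Phi GK \<phi> gens k \<rho> (fox (b div k) (rels ! (a div k))) $$ (a mod k, b mod k))"

definition remove_block_col :: "nat \<Rightarrow> nat \<Rightarrow> 'a mat \<Rightarrow> 'a mat" where
  "remove_block_col k j M = mat (dim_row M) (dim_col M - k) (\<lambda>(a, b).
     M $$ (a, if b < k * j then b else b + k))"

text \<open>Wada's quotient formed with the \<^term>\<open>j\<close>-th generator.\<close>
definition twisted_alexander ::
    "('g, 'x) monoid_scheme \<Rightarrow> ('g \<Rightarrow> int) \<Rightarrow> 'g list \<Rightarrow> word list \<Rightarrow> nat \<Rightarrow> nat \<Rightarrow> ('g \<Rightarrow> 'r::idom mat)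
      \<Rightarrow> 'r laurent fract" where
  "twisted_alexander GK \<phi> gens rels j k \<rho> =
     Fract (Determinant.det (remove_block_col k j (fox_matrix GK \<phi> gens rels k \<rho>)))
           (Determinant.det (Phi GK \<phi> gens k \<rho> (frag_of [(j, True)] - frag_of [])))"

section \<open>The regular representation\<close>

text \<open>Right multiplication on the basis of group elements, matrices acting on row vectors: the row
  of \<^term>\<open>x\<close> has its entry $1$ in the column of $x g$.  Basis elements are numbered by the
  enumeration \<^const>\<open>from_nat_into\<close> of the finite carrier.\<close>
definition regular_rep :: "('a, 'b) monoid_scheme \<Rightarrow> 'a \<Rightarrow> int mat" where
  "regular_rep G g = mat (order G) (order G) (\<lambda>(a, b).
     if from_nat_into (carrier G) a \<otimes>\<^bsub>G\<^esub> g = from_nat_into (carrier G) b then 1 else 0)"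

end

theory Submission
  imports Defs "HOL-Algebra.Group_Action"
begin

text \<open>Modulo $p$ the representation of \<open>G\<close> is compared with that of \<open>G/H\<close> on the level of
  determinants.  A matrix with blocks in the regular representation is invariant under left
  multiplication of row and column indices by \<open>H\<close>.  Hence \<open>H\<close> acts by conjugation on the permutations
  in the Leibniz formula, preserving the terms, and since \<open>H\<close> is a $p$-group only the \<open>H\<close>-equivariant
  permutations contribute in characteristic $p$.  Such a permutation is a permutation \<open>\<pi>\<close> of the
  orbits together with an element of \<open>H\<close> for each orbit, and its term is a $p^n$-th power; by the
  freshman's dream the sum is the $p^n$-th power of the determinant of the matrix summed over
  \<open>H\<close>-orbits, which is the one formed with \<open>G/H\<close>.  This applies to numerator and denominator of
  Wada's quotient.  The two quotients may be formed with different generators, because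
  $\sum_l \Phi(\partial r/\partial s_l)\,\Phi(s_l - 1) = \Phi(r - 1) = 0$ shows that
  $\det M_i \cdot \det\Phi(s_j - 1) = \pm \det M_j \cdot \det\Phi(s_i - 1)$.\<close>

section \<open>Determinants invariant under a finite $p$-group\<close>

text \<open>The Leibniz formula with rows and columns indexed by one and the same unordered set, so
  that a group can act on the indices themselves.\<close>

definition det_on :: "'x set \<Rightarrow> ('x \<Rightarrow> 'x \<Rightarrow> 'r::comm_ring_1) \<Rightarrow> 'r" where
  "det_on X A = (\<Sum>\<sigma> | \<sigma> permutes X. of_int (sign \<sigma>) * (\<Prod>x\<in>X. A x (\<sigma> x)))"

text \<open>Transporting permutations along the numbering \<open>e\<close> is a sign-preserving
  bijection that matches the Leibniz terms. Rows and columns use the same \<open>e\<close>, so no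
  sign appears.\<close>

lemma det_mat_eq_det_on:
  assumes e: "bij_betw e {0..<n} X"
  shows "det (mat n n (\<lambda>(a, b). A (e a) (e b))) = det_on X A"
proof -
  let ?T = "\<lambda>\<pi>. map_permutation {0..<n} e \<pi>"
  have eq: "?T = (\<lambda>\<pi> x. if x \<in> X then e (\<pi> (inv_into {0..<n} e x)) else x)"
    using e by (auto simp: map_permutation_def restrict_id_def bij_betw_def fun_eq_iff)
  have bij: "bij_betw ?T {\<pi>. \<pi> permutes {0..<n}} {\<pi>. \<pi> permutes X}"
    unfolding eq by (rule bij_betw_permutations[OF e])
  have inj: "inj_on e {0..<n}" using e by (simp add: bij_betw_def)
  have "det_on X A = (\<Sum>\<pi> | \<pi> permutes {0..<n}. of_int (sign (?T \<pi>)) * (\<Prod>x\<in>X. A x (?T \<pi> x)))"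
    unfolding det_on_def by (rule sum.reindex_bij_betw[OF bij, symmetric])
  also have "\<dots> = (\<Sum>\<pi> | \<pi> permutes {0..<n}. of_int (sign \<pi>) * (\<Prod>i = 0..<n. A (e i) (e (\<pi> i))))"
  proof (rule sum.cong)
    fix \<pi> assume "\<pi> \<in> {\<pi>. \<pi> permutes {0..<n}}"
    then have \<pi>: "\<pi> permutes {0..<n}" by simp
    have "(\<Prod>x\<in>X. A x (?T \<pi> x)) = (\<Prod>i = 0..<n. A (e i) (?T \<pi> (e i)))"
      by (rule prod.reindex_bij_betw[OF e, symmetric])
    also have "\<dots> = (\<Prod>i = 0..<n. A (e i) (e (\<pi> i)))"
      by (rule prod.cong) (auto simp: map_permutation_apply[OF inj])
    finally show "of_int (sign (?T \<pi>)) * (\<Prod>x\<in>X. A x (?T \<pi> x))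
        = of_int (sign \<pi>) * (\<Prod>i = 0..<n. A (e i) (e (\<pi> i)))"
      by (simp add: sign_map_permutation[OF inj \<pi>])
  qed simp
  also have "\<dots> = det (mat n n (\<lambda>(a, b). A (e a) (e b)))"
    by (subst det_def'[of _ n])
      (auto intro!: sum.cong prod.cong simp: permutes_in_image sign_def)
  finally show ?thesis ..
qed

lemma det_on_cong:
  assumes "\<And>x y. x \<in> X \<Longrightarrow> y \<in> X \<Longrightarrow> A x y = B x y"
  shows "det_on X A = det_on X B"
  unfolding det_on_def using assms
  by (intro sum.cong HOL.refl arg_cong2[of _ _ _ _ "(*)"] prod.cong) (auto simp: permutes_in_image)

lemma det_on_reindex:
  assumes e: "bij_betw e Y X" and "finite Y"
  shows "det_on X A = det_on Y (\<lambda>y z. A (e y) (e z))"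
proof -
  obtain c where c: "bij_betw c {0..<card Y} Y"
    using ex_bij_betw_nat_finite[OF \<open>finite Y\<close>] by blast
  have "bij_betw (e \<circ> c) {0..<card Y} X"
    using c e by (rule bij_betw_trans)
  from det_mat_eq_det_on[OF this, of A] det_mat_eq_det_on[OF c, of "\<lambda>y z. A (e y) (e z)"]
  show ?thesis by simp
qed

section \<open>Fixed points of a p-group action in characteristic p\<close>

text \<open>\<open>F\<close> is constant on orbits, and every orbit has a power of \<open>p\<close>
  as its size. An orbit that is not a single fixed point has size divisible by \<open>p\<close>, so
  its contribution vanishes in \<open>'r\<close>.\<close>

lemma (in group_action) sum_fixed_points:
  fixes F :: "'c \<Rightarrow> 'r::comm_ring_1"
  assumes "finite E" and "order G = p ^ n" and "prime p" and "of_nat p = (0 :: 'r)"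
    and inv: "\<And>g x. g \<in> carrier G \<Longrightarrow> x \<in> E \<Longrightarrow> F (\<phi> g x) = F x"
  shows "sum F E = sum F {x\<in>E. \<forall>g\<in>carrier G. \<phi> g x = x}"
proof -
  let ?fix = "\<lambda>x. \<forall>g\<in>carrier G. \<phi> g x = x"
  have orb: "sum F B = (\<Sum>x\<in>B. if ?fix x then F x else 0)" if B: "B \<in> orbits G E \<phi>" for B
  proof -
    obtain x where x: "x \<in> E" "B = orbit G \<phi> x"
      using B by (auto simp: orbits_def)
    have OE: "B \<subseteq> E"
      using x element_image by (auto simp: orbit_def)
    show ?thesis
    proof (cases "?fix x")
      case True
      then have "B \<subseteq> {x}" by (auto simp: x orbit_def)
      then have "B = {x}" using orbit_refl x by blast
      then show ?thesis using True by simp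
    next
      case False
      \<comment> \<open>A fixed point in the orbit of \<open>x\<close> would have to be
        \<open>x\<close> itself, which is not fixed in this case.\<close>
      have nofix: "\<not> ?fix y" if "y \<in> B" for y
      proof
        assume y: "?fix y"
        have "y \<in> E" using that OE by blast
        moreover have "x \<in> orbit G \<phi> y"
          using orbit_sym[of x y] x that \<open>y \<in> E\<close> by auto
        ultimately obtain g where "g \<in> carrier G" "x = \<phi> g y" unfolding orbit_def by blast
        then have "x = y" using y by simp
        then show False using False y by simp
      qed
      have "card B \<noteq> 1"
      proof
        assume "card B = 1"
        then obtain z where "B = {z}" by (auto simp: card_1_singleton_iff)
        moreover have "x \<in> B" using orbit_refl x by auto
        ultimately have "B = {x}" by auto
        then have "\<phi> g x = x" if "g \<in> carrier G" for g
          using x(2) that unfolding orbit_def by blast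
        then show False using False by blast
      qed
      \<comment> \<open>The orbit size divides the group order, hence is a power of
        \<open>p\<close>; as it is not 1, the exponent is positive.\<close>
      moreover have "card B dvd p ^ n"
        using orbit_stabilizer_theorem[OF x(1)] x assms by (metis dvd_triv_left)
      then obtain k where "card B = p ^ k"
        using divides_primepow_nat \<open>prime p\<close> by blast
      ultimately have "p dvd card B" by (cases k) auto
      then have "of_nat (card B) = (0 :: 'r)"
        using assms(4) by (auto simp: dvd_def)
      moreover have "sum F B = (\<Sum>y\<in>B. F x)"
        using x inv by (intro sum.cong) (auto simp: orbit_def)
      ultimately have "sum F B = 0" by simp
      moreover have "(\<Sum>x\<in>B. if ?fix x then F x else 0) = 0"
        by (rule sum.neutral) (use nofix in auto)
      ultimately show ?thesis by simp
    qed
  qed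
  have "sum F E = (\<Sum>B\<in>orbits G E \<phi>. sum F B)"
    by (rule disjoint_sum[OF \<open>finite E\<close>, symmetric])
  also have "\<dots> = (\<Sum>B\<in>orbits G E \<phi>. \<Sum>x\<in>B. if ?fix x then F x else 0)"
    by (rule sum.cong[OF HOL.refl]) (rule orb)
  also have "\<dots> = (\<Sum>x\<in>E. if ?fix x then F x else 0)"
    by (rule disjoint_sum[OF \<open>finite E\<close>])
  also have "\<dots> = sum F {x\<in>E. ?fix x}"
    using \<open>finite E\<close> by (simp add: sum.inter_filter)
  finally show ?thesis .
qed

section \<open>Signs of permutations\<close>

lemma sign_funpow:
  assumes "permutation f"
  shows "sign (f ^^ k) = sign f ^ k"
proof -
  have "permutation (f ^^ k) \<and> sign (f ^^ k) = sign f ^ k"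
    by (induction k) (simp_all add: assms permutation_compose sign_compose del: comp_apply)
  then show ?thesis ..
qed

lemma sign_eq_1_if_funpow_odd:
  assumes "permutation f" and "f ^^ k = id" and "odd k"
  shows "sign f = 1"
  using sign_funpow[OF assms(1), of k] assms by (cases f rule: sign_cases) auto

text \<open>The copy of \<pi> on a single fibre \<open>{h} \<times> Y\<close> is a transport of
  \<pi> and has the same sign; the copies on different fibres are composed one by one. The set
  \<open>S\<close> of fibres is kept arbitrary for this induction.\<close>

lemma sign_map_prod_restrict:
  assumes "finite S" and "\<pi> permutes Y" and "finite Y"
  defines "L \<equiv> \<lambda>S. \<lambda>(h, y). if h \<in> S \<and> y \<in> Y then (h, \<pi> y) else (h, y)"
  shows "L S permutes (S \<times> Y) \<and> sign (L S) = sign \<pi> ^ card S"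
  using assms(1)
proof (induction S)
  case empty
  have "L {} = id" by (rule ext) (auto simp: L_def)
  show ?case unfolding \<open>L {} = id\<close> by (intro conjI permutes_id) simp
next
  case (insert h S)
  let ?e = "\<lambda>y. (h, y)"
  let ?q = "map_permutation Y ?e \<pi>"
  have inj: "inj_on ?e Y" by (simp add: inj_on_def)
  have q: "?q permutes {h} \<times> Y"
    by (rule map_permutation_permutes) (use assms in \<open>auto simp: bij_betw_def inj_on_def\<close>)
  have q_app: "?q (g, y) = (if g = h \<and> y \<in> Y then (h, \<pi> y) else (g, y))" for g y
  proof (cases "g = h \<and> y \<in> Y")
    case True
    then show ?thesis using map_permutation_apply[OF inj, of y \<pi>] by simp
  next
    case False
    then show ?thesis using permutes_not_in[OF q, of "(g, y)"] by auto
  qed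
  have LS: "L (insert h S) = L S \<circ> ?q"
    using insert.hyps assms(2)
    by (auto simp: L_def q_app fun_eq_iff permutes_in_image)
  have perm1: "L S permutes insert h S \<times> Y"
    by (rule permutes_subset[of _ "S \<times> Y"]) (use insert.IH in auto)
  have perm2: "?q permutes insert h S \<times> Y"
    by (rule permutes_subset[OF q]) auto
  have fin: "finite (insert h S \<times> Y)" using insert.hyps \<open>finite Y\<close> by simp
  have "sign (L (insert h S)) = sign (L S) * sign ?q"
    unfolding LS by (rule sign_compose) (use perm1 perm2 fin permutes_imp_permutation in blast)+
  moreover have "L (insert h S) permutes insert h S \<times> Y"
    unfolding LS by (rule permutes_compose[OF perm2 perm1])
  ultimately show ?case
    using insert sign_map_permutation[OF inj assms(2,3)] by simp
qed

section \<open>Equivariant permutations of a free action\<close>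

context group
begin

text \<open>These are the elements of the wreath product of \<open>G\<close> with the permutations
  of \<open>Y\<close>. Multiplication by \<open>d y\<close> from the right makes them commute with
  left translations; elsewhere they are the identity, as \<open>permutes\<close> demands.\<close>

definition wreath :: "'y set \<Rightarrow> ('y \<Rightarrow> 'y) \<Rightarrow> ('y \<Rightarrow> 'a) \<Rightarrow> 'a \<times> 'y \<Rightarrow> 'a \<times> 'y" where
  "wreath Y \<pi> d = (\<lambda>(h, y). if h \<in> carrier G \<and> y \<in> Y then (h \<otimes> d y, \<pi> y) else (h, y))"

lemma wreath_permutes:
  assumes "\<pi> permutes Y" and "d \<in> Y \<rightarrow> carrier G"
  shows "wreath Y \<pi> d permutes carrier G \<times> Y"
proof (rule bij_imp_permutes)
  show "bij_betw (wreath Y \<pi> d) (carrier G \<times> Y) (carrier G \<times> Y)"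
  \<comment> \<open>The preimage of \<open>(h, y)\<close> lies over the \<pi>-preimage of
    \<open>y\<close>, and the factor to cancel is the value of \<open>d\<close> there.\<close>
  proof (rule bij_betw_byWitness[where f' = "\<lambda>(h, y). (h \<otimes> inv (d (inv_into UNIV \<pi> y)), inv_into UNIV \<pi> y)"])
    show "\<forall>a\<in>carrier G \<times> Y. (case wreath Y \<pi> d a of (h, y) \<Rightarrow> (h \<otimes> inv d (inv_into UNIV \<pi> y), inv_into UNIV \<pi> y)) = a"
      using assms by (auto simp: wreath_def permutes_inverses m_assoc Pi_iff)
    show "\<forall>a'\<in>carrier G \<times> Y. wreath Y \<pi> d (case a' of (h, y) \<Rightarrow> (h \<otimes> inv d (inv_into UNIV \<pi> y), inv_into UNIV \<pi> y)) = a'"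
      using assms permutes_in_image[OF permutes_inv[OF assms(1)]]
      by (auto simp: wreath_def permutes_inverses m_assoc Pi_iff)
    show "wreath Y \<pi> d ` (carrier G \<times> Y) \<subseteq> carrier G \<times> Y"
      using assms by (auto simp: wreath_def permutes_in_image Pi_iff)
    show "(\<lambda>(h, y). (h \<otimes> inv d (inv_into UNIV \<pi> y), inv_into UNIV \<pi> y)) ` (carrier G \<times> Y) \<subseteq> carrier G \<times> Y"
      using assms permutes_in_image[OF permutes_inv[OF assms(1)]] by (auto simp: Pi_iff)
  qed
qed (auto simp: wreath_def split: if_splits)

text \<open>The permutation factors into right multiplications within the fibres followed by \<pi>
  applied to every fibre. The first factor is killed by the odd power \<open>order G\<close>, hence
  is even; the second consists of an odd number of copies of \<pi>.\<close>

lemma sign_wreath_odd: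
  assumes "\<pi> permutes Y" and d: "d \<in> Y \<rightarrow> carrier G" and "finite Y" and "finite (carrier G)"
    and "odd (order G)"
  shows "sign (wreath Y \<pi> d) = sign \<pi>"
proof -
  let ?X = "carrier G \<times> Y"
  have perm: "permutation f" if "f permutes ?X" for f
    using that assms permutes_imp_permutation[of ?X f] by simp
  have p1: "wreath Y id d permutes ?X" by (rule wreath_permutes) (use d in auto)
  have p2: "wreath Y \<pi> (\<lambda>_. \<one>) permutes ?X" by (rule wreath_permutes) (use assms in auto)
  have pow: "(wreath Y id d ^^ k) (h, y) = (if h \<in> carrier G \<and> y \<in> Y then (h \<otimes> d y [^] k, y) else (h, y))"
    for k h y
    by (induction k) (use d in \<open>auto simp: wreath_def m_assoc Pi_iff\<close>)
  have "(wreath Y id d ^^ order G) = id"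
  proof (rule ext, clarify)
    fix h y
    have "d y [^] order G = \<one>" if "y \<in> Y" using pow_order_eq_1 d that by blast
    then show "(wreath Y id d ^^ order G) (h, y) = id (h, y)" unfolding pow by auto
  qed
  then have s1: "sign (wreath Y id d) = 1"
    using sign_eq_1_if_funpow_odd[OF perm[OF p1]] \<open>odd (order G)\<close> by blast
  have "wreath Y \<pi> (\<lambda>_. \<one>) = (\<lambda>(h, y). if h \<in> carrier G \<and> y \<in> Y then (h, \<pi> y) else (h, y))"
    by (auto simp: wreath_def fun_eq_iff)
  then have "sign (wreath Y \<pi> (\<lambda>_. \<one>)) = sign \<pi> ^ order G"
    using sign_map_prod_restrict[OF assms(4,1,3)] by (simp add: order_def)
  also have "\<dots> = sign \<pi>"
    using \<open>odd (order G)\<close> by (cases \<pi> rule: sign_cases) auto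
  finally have s2: "sign (wreath Y \<pi> (\<lambda>_. \<one>)) = sign \<pi>" .
  have "wreath Y \<pi> d = wreath Y \<pi> (\<lambda>_. \<one>) \<circ> wreath Y id d"
    using d by (auto simp: wreath_def fun_eq_iff Pi_iff)
  then show ?thesis
    using sign_compose[OF perm[OF p2] perm[OF p1]] s1 s2 by simp
qed


text \<open>Equivariance under left translation determines \<sigma> by its values at the points
  \<open>(\<one>, y)\<close>: their second components form \<pi>, their first components form
  \<open>d\<close>.\<close>

lemma wreath_fixed_iff:
  assumes "\<sigma> permutes carrier G \<times> Y"
  shows "(\<forall>g\<in>carrier G. \<forall>h\<in>carrier G. \<forall>y\<in>Y. \<sigma> (g \<otimes> h, y) = (g \<otimes> fst (\<sigma> (h, y)), snd (\<sigma> (h, y))))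
    \<longleftrightarrow> (\<exists>\<pi> d. \<pi> permutes Y \<and> d \<in> Y \<rightarrow>\<^sub>E carrier G \<and> \<sigma> = wreath Y \<pi> d)" (is "?L \<longleftrightarrow> ?R")
proof
  assume ?R
  then show ?L
    by (auto simp: wreath_def m_assoc PiE_iff)
next
  assume eqv: ?L
  define \<pi> where "\<pi> = (\<lambda>y. if y \<in> Y then snd (\<sigma> (\<one>, y)) else y)"
  define d where "d = (\<lambda>y\<in>Y. fst (\<sigma> (\<one>, y)))"
  have in1: "\<sigma> (\<one>, y) \<in> carrier G \<times> Y" if "y \<in> Y" for y
    using permutes_in_image[OF assms] that by simp
  have \<sigma>: "\<sigma> (g, y) = (g \<otimes> d y, \<pi> y)" if "g \<in> carrier G" "y \<in> Y" for g y
    using eqv[rule_format, of g \<one> y] that by (simp add: d_def \<pi>_def)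
  have d: "d \<in> Y \<rightarrow>\<^sub>E carrier G"
    using in1 by (auto simp: d_def mem_Times_iff)
  have "bij_betw \<pi> Y Y"
  proof (rule bij_betw_imageI)
    show "inj_on \<pi> Y"
    proof (rule inj_onI)
      fix y z assume yz: "y \<in> Y" "z \<in> Y" "\<pi> y = \<pi> z"
      \<comment> \<open>Both sides equal \<open>(\<one>, \<pi> y)\<close>, so injectivity of
        \<sigma> applies.\<close>
      have "\<sigma> (inv (d y), y) = \<sigma> (inv (d z), z)"
        using yz d by (auto simp: \<sigma> PiE_iff)
      then show "y = z" using permutes_inj[OF assms] by (auto dest: injD)
    qed
    show "\<pi> ` Y = Y"
    proof
      show "\<pi> ` Y \<subseteq> Y" using in1 by (auto simp: \<pi>_def mem_Times_iff)
      show "Y \<subseteq> \<pi> ` Y"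
      proof
        fix y assume "y \<in> Y"
        then have "(\<one>, y) \<in> \<sigma> ` (carrier G \<times> Y)" using permutes_image[OF assms] by simp
        then obtain g z where "g \<in> carrier G" "z \<in> Y" "\<sigma> (g, z) = (\<one>, y)" by force
        then show "y \<in> \<pi> ` Y" using \<sigma> by auto
      qed
    qed
  qed
  then have "\<pi> permutes Y" by (rule bij_imp_permutes) (simp add: \<pi>_def)
  moreover have "\<sigma> = wreath Y \<pi> d"
  proof (rule ext, clarify)
    fix g y show "\<sigma> (g, y) = wreath Y \<pi> d (g, y)"
      using \<sigma> permutes_not_in[OF assms, of "(g, y)"] by (auto simp: wreath_def)
  qed
  ultimately show ?R using d by blast
qed

text \<open>Evaluation at \<open>(\<one>, y)\<close> recovers \<open>d y\<close> and
  \<open>\<pi> y\<close>, and extensionality fixes \<open>d\<close> off \<open>Y\<close>. A sum over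
  equivariant permutations can therefore be reindexed by the pairs of \<pi> and
  \<open>d\<close>.\<close>

lemma inj_on_wreath:
  "inj_on (\<lambda>(\<pi>, d). wreath Y \<pi> d) ({\<pi>. \<pi> permutes Y} \<times> (Y \<rightarrow>\<^sub>E carrier G))"
proof (rule inj_onI, clarify)
  fix \<pi> \<pi>' d d'
  assume p: "\<pi> permutes Y" "\<pi>' permutes Y" and d: "d \<in> Y \<rightarrow>\<^sub>E carrier G" "d' \<in> Y \<rightarrow>\<^sub>E carrier G"
    and eq: "wreath Y \<pi> d = wreath Y \<pi>' d'"
  have *: "d y = d' y \<and> \<pi> y = \<pi>' y" if "y \<in> Y" for y
    using fun_cong[OF eq, of "(\<one>, y)"] that d by (auto simp: wreath_def PiE_iff)
  moreover have "\<pi> y = y \<and> \<pi>' y = y" if "y \<notin> Y" for y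
    using that p permutes_not_in by metis
  ultimately have "\<pi> = \<pi>'" by (metis ext)
  moreover have "d = d'" by (rule PiE_ext[OF d]) (use * in auto)
  ultimately show "\<pi> = \<pi>' \<and> d = d'" by simp
qed

text \<open>\<open>T g\<close> is left translation by \<open>g\<close>, extended by the identity,
  and is multiplicative in \<open>g\<close>, so conjugation by it is an action. The maps are
  restricted to the set of permutations because the elements of \<open>BijGroup\<close> are
  extensional functions.\<close>

lemma conjugation_action_on_permutations:
  fixes Y :: "'y set"
  defines "X \<equiv> carrier G \<times> Y" and "T \<equiv> \<lambda>g (h, y). if h \<in> carrier G \<and> y \<in> Y then (g \<otimes> h, y) else (h, y)"
  shows "group_action G {\<sigma>. \<sigma> permutes X} (\<lambda>g. \<lambda>\<sigma>\<in>{\<sigma>. \<sigma> permutes X}. T g \<circ> \<sigma> \<circ> T (inv g))" (is "group_action G ?E ?\<phi>")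
    and "\<And>g. g \<in> carrier G \<Longrightarrow> T g permutes X"
    and "\<And>g. g \<in> carrier G \<Longrightarrow> T g \<circ> T (inv g) = id"
    and "\<And>g. g \<in> carrier G \<Longrightarrow> T (inv g) \<circ> T g = id"
proof -
  have mult: "T (g \<otimes> h) = T g \<circ> T h" if "g \<in> carrier G" "h \<in> carrier G" for g h
    using that by (auto simp: T_def fun_eq_iff m_assoc)
  have one: "T \<one> = id"
    by (auto simp: T_def fun_eq_iff)
  show r: "T g \<circ> T (inv g) = id" if "g \<in> carrier G" for g
    using that mult[of g "inv g"] one by simp
  show l: "T (inv g) \<circ> T g = id" if "g \<in> carrier G" for g
    using that mult[of "inv g" g] one by simp
  show perm: "T g permutes X" if "g \<in> carrier G" for g
  proof (rule bij_imp_permutes)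
    show "bij_betw (T g) X X"
      by (rule bij_betw_byWitness[where f' = "T (inv g)"])
        (use fun_cong[OF r[OF that]] fun_cong[OF l[OF that]] that in \<open>auto simp: T_def X_def\<close>)
  qed (auto simp: T_def X_def split: if_splits)
  define E where "E = ?E"
  define f where "f = (\<lambda>g. \<lambda>\<sigma>\<in>E. T g \<circ> \<sigma> \<circ> T (inv g))"
  have \<phi>: "f g \<in> E \<rightarrow>\<^sub>E E" if "g \<in> carrier G" for g
    using that perm by (auto simp: f_def E_def intro!: permutes_compose)
  have \<phi>_mult: "f (g \<otimes> h) = compose E (f g) (f h)" if "g \<in> carrier G" "h \<in> carrier G" for g h
  proof (rule extensionalityI[of _ E])
    fix \<sigma> assume "\<sigma> \<in> E"
    moreover have "f h \<sigma> \<in> E" using PiE_mem[OF \<phi>] that \<open>\<sigma> \<in> E\<close> by blast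
    ultimately show "f (g \<otimes> h) \<sigma> = compose E (f g) (f h) \<sigma>"
      using that by (simp add: f_def compose_eq mult inv_mult_group comp_assoc)
  qed (simp_all add: f_def)
  have \<phi>_one: "f \<one> = (\<lambda>\<sigma>\<in>E. \<sigma>)"
    by (auto simp: f_def one)
  have bij: "f g \<in> Bij E" if "g \<in> carrier G" for g
  proof -
    have "compose E (f (inv g)) (f g) = (\<lambda>\<sigma>\<in>E. \<sigma>)" "compose E (f g) (f (inv g)) = (\<lambda>\<sigma>\<in>E. \<sigma>)"
      using that by (simp_all add: \<phi>_mult[symmetric] \<phi>_one)
    then have *: "f (inv g) (f g \<sigma>) = \<sigma>" "f g (f (inv g) \<sigma>) = \<sigma>" if "\<sigma> \<in> E" for \<sigma>
      using that by (simp_all add: fun_eq_iff compose_def split: if_splits)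
    have "bij_betw (f g) E E"
    proof (rule bij_betw_byWitness[where f' = "f (inv g)"])
      show "f g ` E \<subseteq> E" using PiE_mem[OF \<phi>[OF that]] by blast
      show "f (inv g) ` E \<subseteq> E" using PiE_mem[OF \<phi>[OF inv_closed[OF that]]] by blast
    qed (use * in blast)+
    then show ?thesis using \<phi>[OF that] by (simp add: Bij_def PiE_def)
  qed
  have "group_action G E f"
    unfolding group_action_def group_hom_def group_hom_axioms_def
  proof (intro conjI homI)
    show "group (BijGroup E)" by (rule group_BijGroup)
    show "group G" by (rule is_group)
    show "f g \<in> carrier (BijGroup E)" if "g \<in> carrier G" for g
      using bij[OF that] by (simp add: BijGroup_def)
    show "f (g \<otimes> h) = f g \<otimes>\<^bsub>BijGroup E\<^esub> f h" if "g \<in> carrier G" "h \<in> carrier G" for g h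
      using \<phi>_mult[OF that] bij that by (simp add: BijGroup_def)
  qed
  then show "group_action G ?E ?\<phi>" unfolding f_def E_def .
qed

section \<open>Determinants of invariant matrices in characteristic p\<close>

text \<open>The group \<open>G\<close> here is the p-group called \<open>H\<close> in the overview;
  it acts freely on \<open>carrier G \<times> Y\<close>, and \<open>Y\<close> is the set of orbits.
  On the right each row orbit is represented by \<open>(\<one>, y)\<close>, while the columns are
  summed over their orbit.\<close>

theorem det_on_invariant_p_group:
  fixes A :: "'a \<times> 'y \<Rightarrow> 'a \<times> 'y \<Rightarrow> 'r::comm_ring_1"
  assumes "order G = p ^ n" and "prime p" and p: "CHAR('r) = p" and "finite Y"
    and inv: "\<And>g h h' y y'. g \<in> carrier G \<Longrightarrow> h \<in> carrier G \<Longrightarrow> h' \<in> carrier G \<Longrightarrow> y \<in> Y \<Longrightarrow> y' \<in> Y \<Longrightarrow>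
      A (g \<otimes> h, y) (g \<otimes> h', y') = A (h, y) (h', y')"
  shows "det_on (carrier G \<times> Y) A = det_on Y (\<lambda>y y'. \<Sum>h\<in>carrier G. A (\<one>, y) (h, y')) ^ p ^ n"
proof -
  define X where "X = carrier G \<times> Y"
  define T where "T = (\<lambda>g (h, y). if h \<in> carrier G \<and> y \<in> Y then (g \<otimes> h, y) else (h, y))"
  define E where "E = {\<sigma>. \<sigma> permutes X}"
  define \<phi> where "\<phi> = (\<lambda>g. \<lambda>\<sigma>\<in>E. T g \<circ> \<sigma> \<circ> T (inv g))"
  define F :: "_ \<Rightarrow> 'r" where "F = (\<lambda>\<sigma>. of_int (sign \<sigma>) * (\<Prod>x\<in>X. A x (\<sigma> x)))"
  define q where "q = p ^ n"
  have "finite (carrier G)"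
    using assms(1,2) by (metis card.infinite order_def power_eq_0_iff not_prime_0)
  then have finX: "finite X" using \<open>finite Y\<close> by (simp add: X_def)
  then have "finite E" unfolding E_def by (rule finite_permutations)
  have act: "group_action G E \<phi>"
    and T_perm: "\<And>g. g \<in> carrier G \<Longrightarrow> T g permutes X"
    and TT: "\<And>g. g \<in> carrier G \<Longrightarrow> T g \<circ> T (inv g) = id" "\<And>g. g \<in> carrier G \<Longrightarrow> T (inv g) \<circ> T g = id"
    unfolding E_def \<phi>_def X_def T_def by (fact conjugation_action_on_permutations)+
  have perm: "permutation \<sigma>" if "\<sigma> permutes X" for \<sigma>
    using that finX permutes_imp_permutation by blast
  have A_T: "A (T g x) (T g x') = A x x'" if "g \<in> carrier G" "x \<in> X" "x' \<in> X" for g x x'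
    using that inv by (auto simp: T_def X_def)
  \<comment> \<open>Conjugation by \<open>T g\<close> keeps the sign, and reindexing the product
    along \<open>T g\<close> returns the old entries by the invariance of \<open>A\<close>.\<close>
  have F_inv: "F (\<phi> g \<sigma>) = F \<sigma>" if g: "g \<in> carrier G" and \<sigma>: "\<sigma> \<in> E" for g \<sigma>
  proof -
    have \<sigma>': "\<sigma> permutes X" using \<sigma> by (simp add: E_def)
    have Tg: "T g permutes X" "T (inv g) permutes X" using T_perm g by auto
    have \<phi>: "\<phi> g \<sigma> = T g \<circ> (\<sigma> \<circ> T (inv g))" using \<sigma> by (simp add: \<phi>_def o_assoc)
    have "sign (T g) * sign (T (inv g)) = 1"
      using sign_compose[OF perm[OF Tg(1)] perm[OF Tg(2)]] TT(1)[OF g] by simp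
    moreover have "sign (\<phi> g \<sigma>) = sign (T g) * (sign \<sigma> * sign (T (inv g)))"
      unfolding \<phi> sign_compose[OF perm[OF Tg(1)] perm[OF permutes_compose[OF Tg(2) \<sigma>']]]
        sign_compose[OF perm[OF \<sigma>'] perm[OF Tg(2)]] ..
    ultimately have "sign (\<phi> g \<sigma>) = sign \<sigma>" by (simp add: mult.left_commute)
    moreover have "(\<Prod>x\<in>X. A x (\<phi> g \<sigma> x)) = (\<Prod>x\<in>X. A (T g x) (\<phi> g \<sigma> (T g x)))"
      by (rule prod.reindex_bij_betw[OF permutes_imp_bij[OF Tg(1)], symmetric])
    moreover have "\<dots> = (\<Prod>x\<in>X. A x (\<sigma> x))"
    proof (rule prod.cong)
      fix x assume "x \<in> X"
      moreover have "\<phi> g \<sigma> (T g x) = T g (\<sigma> x)"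
        using fun_cong[OF TT(2)[OF g], of x] by (simp add: \<phi>)
      ultimately show "A (T g x) (\<phi> g \<sigma> (T g x)) = A x (\<sigma> x)"
        using A_T[OF g] permutes_in_image[OF \<sigma>'] by simp
    qed simp
    ultimately show ?thesis by (simp add: F_def)
  qed
  \<comment> \<open>Being fixed by conjugation means commuting with all translations, which is the
    equivariance condition of \<open>wreath_fixed_iff\<close>.\<close>
  have fix_eq: "{\<sigma>\<in>E. \<forall>g\<in>carrier G. \<phi> g \<sigma> = \<sigma>}
      = (\<lambda>(\<pi>, d). wreath Y \<pi> d) ` ({\<pi>. \<pi> permutes Y} \<times> (Y \<rightarrow>\<^sub>E carrier G))" (is "?Fix = ?W")
  proof -
    have "\<phi> g \<sigma> = \<sigma> \<longleftrightarrow> (\<forall>h\<in>carrier G. \<forall>y\<in>Y. \<sigma> (g \<otimes> h, y) = (g \<otimes> fst (\<sigma> (h, y)), snd (\<sigma> (h, y))))"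
      if \<sigma>: "\<sigma> permutes X" and g: "g \<in> carrier G" for g \<sigma>
    proof -
      have "\<phi> g \<sigma> = \<sigma> \<longleftrightarrow> T g \<circ> \<sigma> = \<sigma> \<circ> T g"
      proof
        assume "\<phi> g \<sigma> = \<sigma>"
        then have "(T g \<circ> \<sigma>) \<circ> T (inv g) \<circ> T g = \<sigma> \<circ> T g" using \<sigma> by (simp add: \<phi>_def E_def)
        then show "T g \<circ> \<sigma> = \<sigma> \<circ> T g" using TT(2)[OF g] by (simp add: comp_assoc)
      next
        assume "T g \<circ> \<sigma> = \<sigma> \<circ> T g"
        then have "(T g \<circ> \<sigma>) \<circ> T (inv g) = \<sigma> \<circ> (T g \<circ> T (inv g))" by (simp add: comp_assoc)
        then show "\<phi> g \<sigma> = \<sigma>" using \<sigma> TT(1)[OF g] by (simp add: \<phi>_def E_def)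
      qed
      also have "\<dots> \<longleftrightarrow> (\<forall>x\<in>X. T g (\<sigma> x) = \<sigma> (T g x))"
      proof
        assume eq: "\<forall>x\<in>X. T g (\<sigma> x) = \<sigma> (T g x)"
        show "T g \<circ> \<sigma> = \<sigma> \<circ> T g"
        proof
          fix x show "(T g \<circ> \<sigma>) x = (\<sigma> \<circ> T g) x"
            using eq permutes_not_in[OF \<sigma>, of x] permutes_not_in[OF T_perm[OF g], of x] by (cases "x \<in> X") auto
        qed
      qed (metis comp_apply)
      also have "\<dots> \<longleftrightarrow> (\<forall>h\<in>carrier G. \<forall>y\<in>Y. \<sigma> (g \<otimes> h, y) = (g \<otimes> fst (\<sigma> (h, y)), snd (\<sigma> (h, y))))"
      proof -
        have "T g (\<sigma> (h, y)) = (g \<otimes> fst (\<sigma> (h, y)), snd (\<sigma> (h, y)))" if "h \<in> carrier G" "y \<in> Y" for h y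
          using permutes_in_image[OF \<sigma>, of "(h, y)"] that
          by (cases "\<sigma> (h, y)") (auto simp: T_def X_def)
        then show ?thesis by (auto simp: X_def T_def)
      qed
      finally show ?thesis .
    qed
    then have "?Fix = {\<sigma>. \<sigma> permutes X \<and> (\<forall>g\<in>carrier G. \<forall>h\<in>carrier G. \<forall>y\<in>Y.
        \<sigma> (g \<otimes> h, y) = (g \<otimes> fst (\<sigma> (h, y)), snd (\<sigma> (h, y))))}"
      unfolding E_def mem_Collect_eq by (intro Collect_cong conj_cong HOL.refl ball_cong) simp
    also have "\<dots> = {\<sigma>. \<sigma> permutes X \<and> (\<exists>\<pi> d. \<pi> permutes Y \<and> d \<in> Y \<rightarrow>\<^sub>E carrier G \<and> \<sigma> = wreath Y \<pi> d)}"
      unfolding X_def by (intro Collect_cong conj_cong HOL.refl wreath_fixed_iff)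
    also have "\<dots> = ?W"
    proof (intro subset_antisym subsetI)
      fix \<sigma> assume "\<sigma> \<in> {\<sigma>. \<sigma> permutes X \<and> (\<exists>\<pi> d. \<pi> permutes Y \<and> d \<in> Y \<rightarrow>\<^sub>E carrier G \<and> \<sigma> = wreath Y \<pi> d)}"
      then obtain \<pi> d where "\<pi> permutes Y" "d \<in> Y \<rightarrow>\<^sub>E carrier G" "\<sigma> = wreath Y \<pi> d" by blast
      then show "\<sigma> \<in> ?W" by (intro image_eqI[of _ _ "(\<pi>, d)"]) simp_all
    next
      fix \<sigma> assume "\<sigma> \<in> ?W"
      then obtain \<pi> d where \<sigma>: "\<pi> permutes Y" "d \<in> Y \<rightarrow>\<^sub>E carrier G" "\<sigma> = wreath Y \<pi> d" by auto
      moreover have "\<sigma> permutes X"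
        unfolding X_def \<sigma>(3) using \<sigma>(1,2) by (intro wreath_permutes) (auto simp: PiE_def)
      ultimately show "\<sigma> \<in> {\<sigma>. \<sigma> permutes X \<and> (\<exists>\<pi> d. \<pi> permutes Y \<and> d \<in> Y \<rightarrow>\<^sub>E carrier G \<and> \<sigma> = wreath Y \<pi> d)}" by blast
    qed
    finally show ?thesis .
  qed
  \<comment> \<open>For \<open>p = 2\<close> all signs become 1 in \<open>'r\<close>; for odd
    \<open>p\<close> the group has odd order and \<open>sign_wreath_odd\<close> applies.\<close>
  have sgn: "(of_int (sign (wreath Y \<pi> d)) :: 'r) = of_int (sign \<pi>)" and sgn_pow: "(of_int (sign \<pi>) :: 'r) ^ q = of_int (sign \<pi>)"
    if \<pi>: "\<pi> permutes Y" and d: "d \<in> Y \<rightarrow> carrier G" for \<pi> d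
  proof -
    have "(of_int (sign (wreath Y \<pi> d)) :: 'r) = of_int (sign \<pi>) \<and> (of_int (sign \<pi>) :: 'r) ^ q = of_int (sign \<pi>)"
    proof (cases "p = 2")
      case True
      have "of_nat 2 = (0 :: 'r)" using of_nat_CHAR[where 'a='r] unfolding p True .
      then have "1 + 1 = (0 :: 'r)" by simp
      then have "(- 1 :: 'r) = 1" by (rule minus_unique)
      then have *: "of_int s = (1 :: 'r)" if "s \<in> {1, - 1}" for s using that by auto
      have "of_int (sign (wreath Y \<pi> d)) = (1 :: 'r)" "of_int (sign \<pi>) = (1 :: 'r)"
        by (rule *, simp add: sign_def)+
      then show ?thesis by simp
    next
      case False
      then have "odd p" using prime_odd_nat[OF \<open>prime p\<close>] prime_ge_2_nat[OF \<open>prime p\<close>] by simp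
      then have "odd q" by (simp add: q_def)
      then show ?thesis
        using sign_wreath_odd[OF \<pi> d \<open>finite Y\<close> \<open>finite (carrier G)\<close>] assms(1)
        by (cases \<pi> rule: sign_cases) (auto simp: q_def)
    qed
    then show "(of_int (sign (wreath Y \<pi> d)) :: 'r) = of_int (sign \<pi>)" "(of_int (sign \<pi>) :: 'r) ^ q = of_int (sign \<pi>)" by auto
  qed
  \<comment> \<open>By invariance the entry taken in row \<open>(h, y)\<close> does not depend on
    \<open>h\<close>, so each \<open>y\<close> contributes the same factor \<open>q\<close>
    times.\<close>
  have F_wreath: "F (wreath Y \<pi> d) = of_int (sign \<pi>) * (\<Prod>y\<in>Y. A (\<one>, y) (d y, \<pi> y) ^ q)"
    if \<pi>: "\<pi> permutes Y" and d: "d \<in> Y \<rightarrow>\<^sub>E carrier G" for \<pi> d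
  proof -
    have "(\<Prod>x\<in>X. A x (wreath Y \<pi> d x)) = (\<Prod>(h, y)\<in>carrier G \<times> Y. A (\<one>, y) (d y, \<pi> y))"
      unfolding X_def
    proof (rule prod.cong, simp, clarify)
      fix h y assume "h \<in> carrier G" "y \<in> Y"
      then show "A (h, y) (wreath Y \<pi> d (h, y)) = A (\<one>, y) (d y, \<pi> y)"
        using inv[of h \<one> "d y" y "\<pi> y"] d permutes_in_image[OF \<pi>] by (auto simp: wreath_def PiE_iff)
    qed
    also have "\<dots> = (\<Prod>h\<in>carrier G. \<Prod>y\<in>Y. A (\<one>, y) (d y, \<pi> y))"
      by (rule prod.cartesian_product[symmetric])
    also have "\<dots> = (\<Prod>y\<in>Y. A (\<one>, y) (d y, \<pi> y)) ^ q"
      using assms(1) by (simp add: order_def q_def)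
    finally show ?thesis
      using sgn[OF \<pi>, of d] d by (simp add: F_def prod_power_distrib PiE_def)
  qed
  have "det_on X A = sum F E"
    by (simp add: det_on_def F_def E_def)
  also have "\<dots> = sum F ?Fix"
    by (rule group_action.sum_fixed_points[OF act \<open>finite E\<close> assms(1,2), where F = F])
      (use of_nat_CHAR[where 'a='r] F_inv in \<open>simp_all add: p\<close>)
  also have "\<dots> = (\<Sum>x\<in>{\<pi>. \<pi> permutes Y} \<times> (Y \<rightarrow>\<^sub>E carrier G). F (case x of (\<pi>, d) \<Rightarrow> wreath Y \<pi> d))"
    unfolding fix_eq by (subst sum.reindex[OF inj_on_wreath]) simp
  also have "\<dots> = (\<Sum>(\<pi>, d)\<in>{\<pi>. \<pi> permutes Y} \<times> (Y \<rightarrow>\<^sub>E carrier G).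
      of_int (sign \<pi>) * (\<Prod>y\<in>Y. A (\<one>, y) (d y, \<pi> y) ^ q))"
    by (rule sum.cong) (auto simp: F_wreath)
  also have "\<dots> = (\<Sum>\<pi> | \<pi> permutes Y. \<Sum>d\<in>Y \<rightarrow>\<^sub>E carrier G. of_int (sign \<pi>) * (\<Prod>y\<in>Y. A (\<one>, y) (d y, \<pi> y) ^ q))"
    by (rule sum.cartesian_product[symmetric])
  \<comment> \<open>The values \<open>d y\<close> are chosen independently, so the sum over
    \<open>d\<close> of products is a product of sums over \<open>h\<close>.\<close>
  also have "\<dots> = (\<Sum>\<pi> | \<pi> permutes Y. of_int (sign \<pi>) * (\<Prod>y\<in>Y. \<Sum>h\<in>carrier G. A (\<one>, y) (h, \<pi> y) ^ q))"
    using \<open>finite Y\<close> \<open>finite (carrier G)\<close> by (subst prod_sum_PiE) (auto simp: sum_distrib_left)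
  \<comment> \<open>The freshman's dream is used twice: here inside each factor, then for the sum
    over \<pi>. The sign equals its own \<open>q\<close>-th power.\<close>
  also have "\<dots> = (\<Sum>\<pi> | \<pi> permutes Y. (of_int (sign \<pi>) * (\<Prod>y\<in>Y. \<Sum>h\<in>carrier G. A (\<one>, y) (h, \<pi> y))) ^ q)"
  proof (rule sum.cong)
    fix \<pi> assume "\<pi> \<in> {\<pi>. \<pi> permutes Y}"
    then have "(of_int (sign \<pi>) :: 'r) ^ q = of_int (sign \<pi>)" using sgn_pow[of \<pi> "\<lambda>_. \<one>"] by simp
    moreover have "(\<Sum>h\<in>carrier G. A (\<one>, y) (h, \<pi> y) ^ q) = (\<Sum>h\<in>carrier G. A (\<one>, y) (h, \<pi> y)) ^ q" for y
      by (rule freshmans_dream_sum'[symmetric]) (use p \<open>prime p\<close> in \<open>auto simp: q_def\<close>)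
    ultimately show "of_int (sign \<pi>) * (\<Prod>y\<in>Y. \<Sum>h\<in>carrier G. A (\<one>, y) (h, \<pi> y) ^ q)
        = (of_int (sign \<pi>) * (\<Prod>y\<in>Y. \<Sum>h\<in>carrier G. A (\<one>, y) (h, \<pi> y))) ^ q"
      by (simp add: power_mult_distrib prod_power_distrib)
  qed simp
  also have "\<dots> = (\<Sum>\<pi> | \<pi> permutes Y. of_int (sign \<pi>) * (\<Prod>y\<in>Y. \<Sum>h\<in>carrier G. A (\<one>, y) (h, \<pi> y))) ^ q"
    by (rule freshmans_dream_sum'[symmetric]) (use p \<open>prime p\<close> in \<open>auto simp: q_def\<close>)
  finally show ?thesis
    unfolding X_def q_def det_on_def .
qed

end

section \<open>Exchanging blocks of columns\<close>

lemma sum_lessThan_add: "sum f {..<r + k} = sum f {..<r} + (\<Sum>y<k. f (r + y))"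
  for f :: "nat \<Rightarrow> 'r::comm_monoid_add"
  by (induction k) (simp_all add: add.assoc)

text \<open>In block form the hypothesis reads \<open>P W + Q U + S V = 0\<close>, so
  \<open>[P | Q]\<close> times \<open>[1, W; 0, U]\<close> equals \<open>[P | S]\<close> times
  \<open>[1, 0; 0, -V]\<close>. The claim follows by taking determinants; the sign is that of
  \<open>det (-V)\<close> against \<open>det V\<close>.\<close>

lemma det_exchange_last_columns:
  fixes P Q S U V W :: "nat \<Rightarrow> nat \<Rightarrow> 'r::idom"
  assumes rel: "\<And>a z. a < r + k \<Longrightarrow> z < k \<Longrightarrow>
    (\<Sum>b<r. P a b * W b z) + (\<Sum>y<k. Q a y * U y z) + (\<Sum>y<k. S a y * V y z) = 0"
  shows "det (mat (r + k) (r + k) (\<lambda>(a, b). if b < r then P a b else Q a (b - r))) * det (mat k k (\<lambda>(y, z). U y z))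
    = (- 1) ^ k * (det (mat (r + k) (r + k) (\<lambda>(a, b). if b < r then P a b else S a (b - r))) * det (mat k k (\<lambda>(y, z). V y z)))"
proof -
  define M where "M = (\<lambda>Q. mat (r + k) (r + k) (\<lambda>(a, b). if b < r then P a b else Q a (b - r)))"
  define B where "B = (\<lambda>W U. four_block_mat (1\<^sub>m r) (mat r k (\<lambda>(b, z). W b z)) (0\<^sub>m k r) (mat k k (\<lambda>(y, z). U y z)) :: 'r mat)"
  have carrier: "M Q \<in> carrier_mat (r + k) (r + k)" "B W U \<in> carrier_mat (r + k) (r + k)" for Q W U
    by (simp_all add: M_def B_def)
  have det_B: "det (B W U) = det (mat k k (\<lambda>(y, z). U y z))" for W U
    unfolding B_def by (subst det_four_block_mat_lower_left_zero[of _ r _ k]) auto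
  have entry: "(M Q * B W U) $$ (a, b) = (if b < r then P a b
      else (\<Sum>c<r. P a c * W c (b - r)) + (\<Sum>y<k. Q a y * U y (b - r)))"
    if "a < r + k" "b < r + k" for Q W U a b
  proof -
    have "(M Q * B W U) $$ (a, b) = (\<Sum>c<r + k. M Q $$ (a, c) * B W U $$ (c, b))"
      using carrier[of Q] carrier(2)[of W U] that by (simp add: scalar_prod_def lessThan_atLeast0)
    also have "\<dots> = (\<Sum>c<r. P a c * (if b < r then if c = b then 1 else 0 else W c (b - r)))
        + (\<Sum>y<k. Q a y * (if b < r then 0 else U y (b - r)))"
      unfolding sum_lessThan_add
      by (intro arg_cong2[of _ _ _ _ "(+)"] sum.cong) (use that in \<open>auto simp: M_def B_def\<close>)
    also have "\<dots> = (if b < r then P a b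
        else (\<Sum>c<r. P a c * W c (b - r)) + (\<Sum>y<k. Q a y * U y (b - r)))"
      by (simp add: if_distrib[of "\<lambda>x. _ * x"] cong: if_cong)
    finally show ?thesis .
  qed
  have "M Q * B W U = M S * B (\<lambda>_ _. 0) (\<lambda>y z. - V y z)"
  proof (rule eq_matI)
    fix a b assume "a < dim_row (M S * B (\<lambda>_ _. 0) (\<lambda>y z. - V y z))" "b < dim_col (M S * B (\<lambda>_ _. 0) (\<lambda>y z. - V y z))"
    then have ab: "a < r + k" "b < r + k"
      using carrier[of S] carrier(2)[of "\<lambda>_ _. 0" "\<lambda>y z. - V y z"] by auto
    then show "(M Q * B W U) $$ (a, b) = (M S * B (\<lambda>_ _. 0) (\<lambda>y z. - V y z)) $$ (a, b)"
      unfolding entry[OF ab] using rel[of a "b - r"]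
      by (auto simp: sum_negf eq_neg_iff_add_eq_0)
  qed (use carrier in \<open>simp_all add: M_def B_def\<close>)
  then have "det (M Q) * det (B W U) = det (M S) * det (B (\<lambda>_ _. 0) (\<lambda>y z. - V y z))"
    by (simp only: det_mult[OF carrier, symmetric])
  moreover have "mat k k (\<lambda>(y, z). - V y z) = (- 1) \<cdot>\<^sub>m mat k k (\<lambda>(y, z). V y z)"
    by (rule eq_matI) auto
  then have "det (mat k k (\<lambda>(y, z). - V y z)) = (- 1) ^ k * det (mat k k (\<lambda>(y, z). V y z))"
    by simp
  ultimately show ?thesis
    unfolding det_B by (simp add: M_def mult.left_commute)
qed

text \<open>The two numberings differ by a permutation of the positions, whose sign is the factor.
  Transposition turns it into a permutation of rows.\<close>

lemma det_reindex_columns: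
  fixes A :: "nat \<Rightarrow> 'c \<Rightarrow> 'r::comm_ring_1"
  assumes c: "bij_betw c {0..<n} S" and c': "bij_betw c' {0..<n} S"
  shows "\<exists>\<epsilon>. \<epsilon> \<in> {1, - 1} \<and> det (mat n n (\<lambda>(a, b). A a (c' b))) = \<epsilon> * det (mat n n (\<lambda>(a, b). A a (c b)))"
proof -
  define p where "p = (\<lambda>b. if b < n then inv_into {0..<n} c (c' b) else b)"
  have "bij_betw (\<lambda>b. inv_into {0..<n} c (c' b)) {0..<n} {0..<n}"
    using bij_betw_trans[OF c' bij_betw_inv_into[OF c]] by (simp add: comp_def)
  then have "bij_betw p {0..<n} {0..<n}"
    by (rule bij_betw_cong[THEN iffD1, rotated]) (simp add: p_def)
  then have p: "p permutes {0..<n}"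
    by (rule bij_imp_permutes) (simp add: p_def)
  have c_p: "c (p b) = c' b" if "b < n" for b
    using that bij_betwE[OF c', rule_format, of b] bij_betw_inv_into_right[OF c] by (simp add: p_def)
  let ?M = "mat n n (\<lambda>(b, a). A a (c b))"
  have "det (mat n n (\<lambda>(a, b). A a (c' b))) = det (transpose_mat (mat n n (\<lambda>(b, a). A a (c' b))))"
    by (rule arg_cong[of _ _ det], rule eq_matI) auto
  also have "\<dots> = det (mat n n (\<lambda>(b, a). A a (c' b)))"
    by (rule det_transpose[of _ n]) simp
  also have "mat n n (\<lambda>(b, a). A a (c' b)) = mat n n (\<lambda>(b, a). ?M $$ (p b, a))"
    by (rule eq_matI) (use permutes_in_image[OF p] c_p in auto)
  also have "det \<dots> = signof p * det ?M"
    by (rule det_permute_rows[OF _ p]) simp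
  also have "det ?M = det (transpose_mat ?M)"
    by (rule det_transpose[of _ n, symmetric]) simp
  also have "transpose_mat ?M = mat n n (\<lambda>(a, b). A a (c b))"
    by (rule eq_matI) auto
  finally show ?thesis
    by (intro exI[of _ "signof p"]) (auto simp: sign_def)
qed

text \<open>Column \<open>(l, y)\<close> is the \<open>y\<close>-th column of block
  \<open>l\<close>. The two matrices share all columns outside blocks \<open>i\<close> and
  \<open>j\<close>; with the one further block moved to the end,
  \<open>det_exchange_last_columns\<close> applies, and the reordering costs only a sign.\<close>

lemma det_exchange_column_block:
  fixes A :: "nat \<Rightarrow> nat \<times> nat \<Rightarrow> 'r::idom" and V :: "nat \<Rightarrow> nat \<Rightarrow> nat \<Rightarrow> 'r"
  assumes rel: "\<And>a z. a < k * (m - 1) \<Longrightarrow> z < k \<Longrightarrow> (\<Sum>l<m. \<Sum>y<k. A a (l, y) * V l y z) = 0"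
    and "i < m" "j < m"
    and ci: "bij_betw ci {0..<k * (m - 1)} (({..<m} - {i}) \<times> {..<k})"
    and cj: "bij_betw cj {0..<k * (m - 1)} (({..<m} - {j}) \<times> {..<k})"
  defines "n \<equiv> k * (m - 1)"
  shows "\<exists>\<epsilon>. \<epsilon> \<in> {1, - 1} \<and>
    det (mat n n (\<lambda>(a, b). A a (ci b))) * det (mat k k (\<lambda>(y, z). V j y z))
      = \<epsilon> * (det (mat n n (\<lambda>(a, b). A a (cj b))) * det (mat k k (\<lambda>(y, z). V i y z)))"
proof (cases "i = j")
  case True
  then show ?thesis
    using det_reindex_columns[OF cj, of ci A] ci unfolding n_def by auto
next
  case False
  let ?R = "({..<m} - {i, j}) \<times> {..<k}"
  obtain e where e: "bij_betw e {0..<card ?R} ?R"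
    using ex_bij_betw_nat_finite[of ?R] by auto
  define r where "r = card ?R"
  have "r = (m - 2) * k"
    using False \<open>i < m\<close> \<open>j < m\<close> by (simp add: r_def card_cartesian_product card_Diff_subset numeral_2_eq_2)
  \<comment> \<open>Two distinct block indices force \<open>m\<close> to be at least 2, so the
    subtraction \<open>m - 2\<close> is not truncated.\<close>
  moreover obtain m' where "m = Suc (Suc m')"
    using False \<open>i < m\<close> \<open>j < m\<close> by (metis less_one not_less_eq old.nat.exhaust less_nat_zero_code)
  ultimately have n: "n = r + k" by (simp add: n_def algebra_simps)
  \<comment> \<open>\<open>c l\<close> lists the common columns first and block \<open>l\<close>
    last. Deleting block \<open>i\<close> thus corresponds to \<open>c j\<close>, and deleting block
    \<open>j\<close> to \<open>c i\<close>.\<close>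
  define c where "c = (\<lambda>l b. if b < r then e b else (l, b - r))"
  have c_bij: "bij_betw (c l) {0..<n} (?R \<union> {l} \<times> {..<k})" if "l \<in> {i, j}" for l
  proof -
    have "bij_betw (c l) {0..<r} ?R"
      by (rule bij_betw_cong[THEN iffD1, OF _ e[folded r_def]]) (simp add: c_def)
    moreover have "bij_betw (c l) {r..<n} ({l} \<times> {..<k})"
      by (rule bij_betw_byWitness[where f' = "\<lambda>(_, y). r + y"]) (auto simp: c_def n)
    ultimately have "bij_betw (c l) ({0..<r} \<union> {r..<n}) (?R \<union> {l} \<times> {..<k})"
      by (rule bij_betw_combine) (use that in auto)
    then show ?thesis by (simp add: n ivl_disj_un)
  qed
  have "?R \<union> {j} \<times> {..<k} = ({..<m} - {i}) \<times> {..<k}" "?R \<union> {i} \<times> {..<k} = ({..<m} - {j}) \<times> {..<k}"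
    using False \<open>i < m\<close> \<open>j < m\<close> by auto
  with c_bij[of i] c_bij[of j]
  have c1: "bij_betw (c j) {0..<n} (({..<m} - {i}) \<times> {..<k})"
    and c2: "bij_betw (c i) {0..<n} (({..<m} - {j}) \<times> {..<k})" by simp_all
  obtain \<epsilon>1 where \<epsilon>1: "\<epsilon>1 \<in> {1, - 1}"
    "det (mat n n (\<lambda>(a, b). A a (ci b))) = \<epsilon>1 * det (mat n n (\<lambda>(a, b). A a (c j b)))"
    using det_reindex_columns[OF c1 ci[folded n_def]] by blast
  obtain \<epsilon>2 where \<epsilon>2: "\<epsilon>2 \<in> {1, - 1}"
    "det (mat n n (\<lambda>(a, b). A a (c i b))) = \<epsilon>2 * det (mat n n (\<lambda>(a, b). A a (cj b)))"
    using det_reindex_columns[OF cj[folded n_def] c2] by blast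
  have mat_c: "mat n n (\<lambda>(a, b). A a (c l b)) = mat (r + k) (r + k) (\<lambda>(a, b). if b < r then A a (e b) else A a (l, b - r))" for l
    by (rule eq_matI) (auto simp: c_def n)
  \<comment> \<open>The matrix \<open>W\<close> stacks the \<open>V l\<close> of the common blocks,
    so the required relation is \<open>rel\<close> with the summands \<open>i\<close> and
    \<open>j\<close> split off.\<close>
  have "det (mat n n (\<lambda>(a, b). A a (c j b))) * det (mat k k (\<lambda>(y, z). V j y z))
      = (- 1) ^ k * (det (mat n n (\<lambda>(a, b). A a (c i b))) * det (mat k k (\<lambda>(y, z). V i y z)))"
    unfolding mat_c
  proof (rule det_exchange_last_columns[where W = "\<lambda>b. case e b of (l, y) \<Rightarrow> V l y"])
    fix a z assume az: "a < r + k" "z < k"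
    have "(\<Sum>b<r. A a (e b) * (case e b of (l, y) \<Rightarrow> V l y) z) = (\<Sum>x\<in>?R. A a x * (case x of (l, y) \<Rightarrow> V l y z))"
      using sum.reindex_bij_betw[OF e[folded r_def], of "\<lambda>x. A a x * (case x of (l, y) \<Rightarrow> V l y z)"]
      by (simp add: lessThan_atLeast0 case_prod_unfold)
    also have "\<dots> = (\<Sum>l\<in>{..<m} - {i, j}. \<Sum>y<k. A a (l, y) * V l y z)"
      by (simp add: sum.cartesian_product case_prod_unfold)
    finally have *: "(\<Sum>b<r. A a (e b) * (case e b of (l, y) \<Rightarrow> V l y) z) = \<dots>" .
    have "(\<Sum>l<m. \<Sum>y<k. A a (l, y) * V l y z)
        = (\<Sum>l\<in>{..<m} - {i, j}. \<Sum>y<k. A a (l, y) * V l y z) + (\<Sum>l\<in>{i, j}. \<Sum>y<k. A a (l, y) * V l y z)"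
      by (rule sum.subset_diff) (use \<open>i < m\<close> \<open>j < m\<close> in auto)
    then show "(\<Sum>b<r. A a (e b) * (case e b of (l, y) \<Rightarrow> V l y) z) + (\<Sum>y<k. A a (j, y) * V j y z)
        + (\<Sum>y<k. A a (i, y) * V i y z) = 0"
      unfolding * using rel[of a z] az False n by (simp add: n_def add_ac)
  qed
  then have "det (mat n n (\<lambda>(a, b). A a (ci b))) * det (mat k k (\<lambda>(y, z). V j y z))
      = (\<epsilon>1 * (- 1) ^ k * \<epsilon>2) * (det (mat n n (\<lambda>(a, b). A a (cj b))) * det (mat k k (\<lambda>(y, z). V i y z)))"
    unfolding \<epsilon>1 \<epsilon>2 by (simp add: mult_ac)
  moreover have "\<epsilon>1 * (- 1) ^ k * \<epsilon>2 \<in> {1, - 1}"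
    using \<epsilon>1(1) \<epsilon>2(1) by (cases "even k") auto
  ultimately show ?thesis by blast
qed

text \<open>This is the numbering of the columns left by \<open>remove_block_col\<close>, split into
  block index and position inside the block.\<close>

lemma bij_betw_skip_block:
  fixes k m j :: nat
  assumes "0 < k" and "j < m"
  shows "bij_betw (\<lambda>b. (if b div k < j then b div k else b div k + 1, b mod k))
    {0..<k * (m - 1)} (({..<m} - {j}) \<times> {..<k})"
\<comment> \<open>Since \<open>l = j\<close> is excluded, \<open>l - 1\<close> is taken only for
  \<open>l > j\<close>.\<close>
proof (rule bij_betw_byWitness[where f' = "\<lambda>(l, y). k * (if l < j then l else l - 1) + y"])
  have *: "b div k < m - 1" if "b < k * (m - 1)" for b
    using that by (simp add: less_mult_imp_div_less mult.commute)
  show "(\<lambda>b. (if b div k < j then b div k else b div k + 1, b mod k)) ` {0..<k * (m - 1)} \<subseteq> ({..<m} - {j}) \<times> {..<k}"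
    using assms * by (fastforce split: if_splits)
  have lt: "k * l + y < k * (m - 1)" if "l < m - 1" "y < k" for l y
  proof -
    have "k * l + y < k * Suc l" using that by simp
    also have "\<dots> \<le> k * (m - 1)" using that by (intro mult_le_mono) auto
    finally show ?thesis .
  qed
  show "(\<lambda>(l, y). k * (if l < j then l else l - 1) + y) ` (({..<m} - {j}) \<times> {..<k}) \<subseteq> {0..<k * (m - 1)}"
  proof (rule image_subsetI)
    fix x assume "x \<in> ({..<m} - {j}) \<times> {..<k}"
    then obtain l y where x: "x = (l, y)" "l < m" "l \<noteq> j" "y < k" by auto
    then have "(if l < j then l else l - 1) < m - 1" using assms by auto
    from lt[OF this \<open>y < k\<close>] show "(case x of (l, y) \<Rightarrow> k * (if l < j then l else l - 1) + y) \<in> {0..<k * (m - 1)}"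
      unfolding x by simp
  qed
qed (use assms in auto)

section \<open>Fox calculus\<close>

lemma single_sum_distrib: "Poly_Mapping.single l (sum g A) = (\<Sum>a\<in>A. Poly_Mapping.single l (g a))"
  by (induction A rule: infinite_finite_induct) (simp_all add: single_add)

text \<open>The additive extension of \<open>g\<close> to formal combinations. Every entry of
  \<open>Phi\<close> is such a value, so linearity is proved once, without matrices.\<close>

definition frag_eval :: "('w \<Rightarrow> 'r::comm_ring_1) \<Rightarrow> ('w \<Rightarrow>\<^sub>0 int) \<Rightarrow> 'r" where
  "frag_eval g z = (\<Sum>w\<in>Poly_Mapping.keys z. of_int (Poly_Mapping.lookup z w) * g w)"

lemma frag_eval_superset:
  assumes "finite K" "Poly_Mapping.keys z \<subseteq> K"
  shows "frag_eval g z = (\<Sum>w\<in>K. of_int (Poly_Mapping.lookup z w) * g w)"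
  unfolding frag_eval_def by (rule sum.mono_neutral_left) (use assms in \<open>auto simp: in_keys_iff\<close>)

lemma frag_eval_of [simp]: "frag_eval g (frag_of w) = g w"
  by (simp add: frag_eval_def)

lemma frag_eval_0 [simp]: "frag_eval g 0 = 0"
  by (simp add: frag_eval_def)

lemma frag_eval_minus: "frag_eval g (- z) = - frag_eval g z"
  by (simp add: frag_eval_def sum_negf)

lemma frag_eval_add: "frag_eval g (z + z') = frag_eval g z + frag_eval g z'"
proof -
  let ?K = "Poly_Mapping.keys z \<union> Poly_Mapping.keys z'"
  have "frag_eval g x = (\<Sum>w\<in>?K. of_int (Poly_Mapping.lookup x w) * g w)" if "x \<in> {z, z', z + z'}" for x
    using that keys_add[of z z'] by (intro frag_eval_superset) auto
  then show ?thesis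
    by (simp add: lookup_add distrib_right sum.distrib)
qed

lemma frag_eval_diff: "frag_eval g (z - z') = frag_eval g z - frag_eval g z'"
  using frag_eval_add[of g z "- z'"] by (simp add: frag_eval_minus)

lemma frag_eval_cmul: "frag_eval g (frag_cmul c z) = of_int c * frag_eval g z"
  by (subst frag_eval_superset[OF _ keys_cmul]) (simp_all add: frag_eval_def sum_distrib_left mult.assoc)

lemma frag_eval_frag_extend: "frag_eval g (frag_extend b z) = frag_eval (\<lambda>w. frag_eval g (b w)) z"
proof -
  have *: "frag_eval g (sum h A) = (\<Sum>a\<in>A. frag_eval g (h a))" for h :: "_ \<Rightarrow> _" and A
    by (induction A rule: infinite_finite_induct) (simp_all add: frag_eval_add)
  show ?thesis
    by (simp add: frag_extend_def * frag_eval_cmul frag_eval_def[of _ z])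
qed

lemma frag_eval_left_mult: "frag_eval g (left_mult u z) = frag_eval (\<lambda>w. g (u @ w)) z"
  by (simp add: left_mult_def frag_eval_frag_extend)

lemma keys_left_mult: "Poly_Mapping.keys (left_mult u z) \<subseteq> (@) u ` Poly_Mapping.keys z"
proof -
  have "Poly_Mapping.keys (left_mult u z) \<subseteq> (\<Union>w\<in>Poly_Mapping.keys z. Poly_Mapping.keys (frag_cmul (Poly_Mapping.lookup z w) (frag_of (u @ w))))"
    unfolding left_mult_def frag_extend_def by (rule keys_sum)
  also have "\<dots> \<subseteq> (@) u ` Poly_Mapping.keys z"
    by (auto split: if_splits)
  finally show ?thesis .
qed

text \<open>\<open>Phi_word\<close> is a matrix of the right size and multiplicative only on words
  in the given letters; this keeps Fox derivatives within them.\<close>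

lemma keys_fox:
  assumes "w \<in> words m"
  shows "Poly_Mapping.keys (fox j w) \<subseteq> words m"
  using assms
proof (induction w)
  case (Cons l w)
  obtain i e where l: "l = (i, e)" by (cases l)
  have w: "w \<in> words m" using Cons.prems by (auto simp: words_def)
  let ?d = "if i = j then if e then frag_of [] else - frag_of [(i, False)] else 0"
  have "Poly_Mapping.keys ?d \<subseteq> words m"
    using Cons.prems by (auto simp: words_def l)
  moreover have "(@) [(i, e)] ` words m \<subseteq> words m"
    using Cons.prems by (auto simp: words_def l)
  then have "Poly_Mapping.keys (left_mult [(i, e)] (fox j w)) \<subseteq> words m"
    using keys_left_mult[of "[(i, e)]" "fox j w"] Cons.IH[OF w] by blast
  moreover have "Poly_Mapping.keys (fox j (l # w)) \<subseteq> Poly_Mapping.keys ?d \<union> Poly_Mapping.keys (left_mult [(i, e)] (fox j w))"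
    unfolding l fox.simps by (rule keys_add)
  ultimately show ?case by blast
qed simp

section \<open>The fundamental formula under a matrix representation\<close>

locale matrix_rep = group GK for GK :: "('g, 'x) monoid_scheme" (structure) +
  fixes \<phi> :: "'g \<Rightarrow> int" and gens :: "'g list" and k :: nat and \<rho> :: "'g \<Rightarrow> 'r::idom mat"
  assumes \<phi>_hom: "\<phi> \<in> hom GK integer_group"
    and gens_closed: "set gens \<subseteq> carrier GK"
    and \<rho>_carrier: "g \<in> carrier GK \<Longrightarrow> \<rho> g \<in> carrier_mat k k"
    and \<rho>_one: "\<rho> \<one> = 1\<^sub>m k"
    and \<rho>_mult: "g \<in> carrier GK \<Longrightarrow> h \<in> carrier GK \<Longrightarrow> \<rho> (g \<otimes> h) = \<rho> g * \<rho> h"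
begin

abbreviation "m \<equiv> length gens"
abbreviation "Pw \<equiv> Phi_word GK \<phi> gens \<rho>"
abbreviation "Ph \<equiv> Phi GK \<phi> gens k \<rho>"

lemma letter_eval_closed: "fst l < m \<Longrightarrow> letter_eval GK gens l \<in> carrier GK"
  using gens_closed nth_mem[of "fst l" gens] by (auto simp: letter_eval_def subset_iff)

lemma word_eval_closed: "w \<in> words m \<Longrightarrow> word_eval GK gens w \<in> carrier GK"
  by (induction w) (auto simp: word_eval_def words_def letter_eval_closed)

lemma word_eval_Cons: "word_eval GK gens (l # w) = letter_eval GK gens l \<otimes> word_eval GK gens w"
  by (simp add: word_eval_def)

lemma Phi_word_carrier: "w \<in> words m \<Longrightarrow> Pw w \<in> carrier_mat k k"
  using \<rho>_carrier[OF word_eval_closed] by (simp add: Phi_word_def Let_def)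

text \<open>A word enters only through the group element it represents. This covers relators as well
  as the cancellation of a letter against its inverse.\<close>

lemma Phi_word_eq_one: "word_eval GK gens w = \<one> \<Longrightarrow> Pw w = 1\<^sub>m k"
proof -
  have "\<phi> \<one> = 0"
    using hom_one[OF \<phi>_hom is_group group_integer_group] by simp
  then show "word_eval GK gens w = \<one> \<Longrightarrow> Pw w = 1\<^sub>m k"
    by (intro eq_matI) (auto simp: Phi_word_def Let_def \<rho>_one single_one)
qed

lemma Phi_word_Nil: "Pw [] = 1\<^sub>m k"
  by (rule Phi_word_eq_one) (simp add: word_eval_def)

lemma Phi_word_Cons:
  assumes "l # w \<in> words m"
  shows "Pw (l # w) = Pw [l] * Pw w"
proof -
  have w: "[l] \<in> words m" "w \<in> words m" "fst l < m" using assms by (auto simp: words_def)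
  define g h where "g = letter_eval GK gens l" and "h = word_eval GK gens w"
  have gh: "g \<in> carrier GK" "h \<in> carrier GK"
    using w by (simp_all add: g_def h_def letter_eval_closed word_eval_closed)
  have eval: "word_eval GK gens (l # w) = g \<otimes> h" "word_eval GK gens [l] = g"
    using gh by (simp_all add: word_eval_Cons g_def h_def) (simp add: word_eval_def g_def)
  have \<phi>: "\<phi> (g \<otimes> h) = \<phi> g + \<phi> h"
    using hom_mult[OF \<phi>_hom gh] by simp
  note c = \<rho>_carrier[OF gh(1)] \<rho>_carrier[OF gh(2)]
  show ?thesis
  proof (rule eq_matI)
    fix a b assume "a < dim_row (Pw [l] * Pw w)" "b < dim_col (Pw [l] * Pw w)"
    then have ab: "a < k" "b < k" using w(1,2)[THEN Phi_word_carrier] by auto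
    have "Pw (l # w) $$ (a, b) = laurent_monom (\<Sum>i = 0..<k. \<rho> g $$ (a, i) * \<rho> h $$ (i, b)) (\<phi> g + \<phi> h)"
      using c ab by (simp add: Phi_word_def Let_def eval \<phi> \<rho>_mult[OF gh] scalar_prod_def)
    also have "\<dots> = (Pw [l] * Pw w) $$ (a, b)"
      using c ab by (simp add: Phi_word_def Let_def eval h_def[symmetric] scalar_prod_def single_sum_distrib mult_single)
    finally show "Pw (l # w) $$ (a, b) = (Pw [l] * Pw w) $$ (a, b)" .
  qed (use w(1,2)[THEN Phi_word_carrier] Phi_word_carrier[OF assms] in auto)
qed

lemma Phi_index: "a < k \<Longrightarrow> b < k \<Longrightarrow> Ph z $$ (a, b) = frag_eval (\<lambda>w. Pw w $$ (a, b)) z"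
  by (simp add: Phi_def frag_eval_def)

lemma Phi_carrier: "Ph z \<in> carrier_mat k k"
  by (simp add: Phi_def)

text \<open>Entrywise form of \<open>\<Phi>(l z) = \<Phi>(l) \<Phi>(z)\<close>, for the
  \<open>left_mult\<close> summand in the recursion of \<open>fox\<close>.\<close>

lemma frag_eval_Phi_word_Cons:
  assumes "Poly_Mapping.keys z \<subseteq> words m" and "[l] \<in> words m" and "a < k" "b < k"
  shows "frag_eval (\<lambda>w. Pw (l # w) $$ (a, b)) z = (\<Sum>c<k. Pw [l] $$ (a, c) * Ph z $$ (c, b))"
proof -
  have "Pw (l # w) $$ (a, b) = (\<Sum>c<k. Pw [l] $$ (a, c) * Pw w $$ (c, b))" if "w \<in> Poly_Mapping.keys z" for w
  proof -
    have "w \<in> words m" using that assms by blast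
    moreover then have "l # w \<in> words m" using assms by (auto simp: words_def)
    ultimately show ?thesis
      using Phi_word_carrier[of "[l]"] Phi_word_carrier[of w] assms
      by (simp add: Phi_word_Cons[of l w] scalar_prod_def lessThan_atLeast0)
  qed
  then have "frag_eval (\<lambda>w. Pw (l # w) $$ (a, b)) z
      = (\<Sum>w\<in>Poly_Mapping.keys z. \<Sum>c<k. Pw [l] $$ (a, c) * (of_int (Poly_Mapping.lookup z w) * Pw w $$ (c, b)))"
    by (simp add: frag_eval_def sum_distrib_left mult.left_commute)
  also have "\<dots> = (\<Sum>c<k. Pw [l] $$ (a, c) * Ph z $$ (c, b))"
    using assms by (subst sum.swap) (simp add: Phi_index frag_eval_def sum_distrib_left)
  finally show ?thesis .
qed

abbreviation "gen_minus_one l \<equiv> frag_of [(l, True)] - frag_of []"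

text \<open>The image under \<Phi> of Fox's formula that \<open>w - 1\<close> is the sum of the
  derivatives of \<open>w\<close> times \<open>s_l - 1\<close>. The induction step splits
  \<open>x w - 1\<close> into \<open>(x - 1) + x (w - 1)\<close>, following the product
  rule.\<close>

lemma fox_fundamental_formula:
  assumes "w \<in> words m" and "a < k" "z < k"
  shows "(\<Sum>l<m. \<Sum>y<k. Ph (fox l w) $$ (a, y) * Ph (gen_minus_one l) $$ (y, z)) = Pw w $$ (a, z) - 1\<^sub>m k $$ (a, z)"
  using assms
proof (induction w arbitrary: a)
  case Nil
  then show ?case by (simp add: Phi_index Phi_word_Nil)
next
  case (Cons x w)
  obtain i e where x: "x = (i, e)" by (cases x)
  have w: "w \<in> words m" "[(i, e)] \<in> words m" "i < m" "[(i, True)] \<in> words m" "[(i, False)] \<in> words m"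
    using Cons.prems by (auto simp: words_def x)
  \<comment> \<open>\<open>C\<close> is the image of the derivative of the letter \<open>x\<close>
    by its own generator: 1 for \<open>s_i\<close>, and \<open>- s_i^{-1}\<close> for its
    inverse.\<close>
  define C where "C = (if e then 1\<^sub>m k else - Pw [(i, False)])"
  let ?D = "\<lambda>l. Ph (gen_minus_one l)"
  have C: "C \<in> carrier_mat k k" using Phi_word_carrier[OF w(5)] by (simp add: C_def)
  have D_i: "?D i = Pw [(i, True)] - 1\<^sub>m k"
    using Phi_word_carrier[OF w(4)] Phi_carrier[of "gen_minus_one i"]
    by (intro eq_matI) (auto simp: Phi_index frag_eval_diff Phi_word_Nil)
  have inv: "Pw [(i, False)] * Pw [(i, True)] = 1\<^sub>m k"
  proof -
    have "gens ! i \<in> carrier GK" using gens_closed w(3) nth_mem by blast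
    then have "word_eval GK gens [(i, False), (i, True)] = \<one>"
      by (simp add: word_eval_def letter_eval_def)
    then have "Pw [(i, False), (i, True)] = 1\<^sub>m k" by (rule Phi_word_eq_one)
    then show ?thesis using Phi_word_Cons[of "(i, False)" "[(i, True)]"] w by (auto simp: words_def)
  qed
  \<comment> \<open>The formula for one letter; for an inverse letter it is
    \<open>- s^{-1} (s - 1) = s^{-1} - 1\<close>.\<close>
  have CD: "C * ?D i = Pw [(i, e)] - 1\<^sub>m k"
    using Phi_word_carrier[OF w(4)] Phi_word_carrier[OF w(5)] inv
    unfolding C_def D_i by (auto simp: mult_minus_distrib_mat uminus_mult_left_mat)
  have fox: "Ph (fox l (x # w)) $$ (a, y) = (if l = i then C $$ (a, y) else 0)
      + (\<Sum>c<k. Pw [(i, e)] $$ (a, c) * Ph (fox l w) $$ (c, y))" if "y < k" for l y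
  proof -
    have "frag_eval (\<lambda>w. Pw w $$ (a, y)) (if i = l then if e then frag_of [] else - frag_of [(i, False)] else 0)
        = (if l = i then C $$ (a, y) else 0)"
      using Phi_word_carrier[OF w(5)] Cons.prems that by (simp add: C_def Phi_word_Nil frag_eval_minus)
    then show ?thesis
      using frag_eval_Phi_word_Cons[OF keys_fox[OF w(1)] w(2) \<open>a < k\<close> \<open>y < k\<close>, of l] Cons.prems that
      by (simp add: x Phi_index frag_eval_add frag_eval_left_mult)
  qed
  have "(\<Sum>l<m. \<Sum>y<k. Ph (fox l (x # w)) $$ (a, y) * ?D l $$ (y, z))
      = (\<Sum>l<m. \<Sum>y<k. (if l = i then C $$ (a, y) else 0) * ?D l $$ (y, z))
      + (\<Sum>l<m. \<Sum>y<k. (\<Sum>c<k. Pw [(i, e)] $$ (a, c) * Ph (fox l w) $$ (c, y)) * ?D l $$ (y, z))"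
    by (simp add: fox distrib_right sum.distrib)
  also have "(\<Sum>l<m. \<Sum>y<k. (if l = i then C $$ (a, y) else 0) * ?D l $$ (y, z))
      = (\<Sum>l<m. if l = i then (\<Sum>y<k. C $$ (a, y) * ?D l $$ (y, z)) else 0)"
    by (rule sum.cong) auto
  also have "\<dots> = (\<Sum>y<k. C $$ (a, y) * ?D i $$ (y, z))"
    using w(3) by simp
  also have "\<dots> = (C * ?D i) $$ (a, z)"
    using C Phi_carrier[of "gen_minus_one i"] Cons.prems by (simp add: scalar_prod_def lessThan_atLeast0)
  also have "\<dots> = Pw [(i, e)] $$ (a, z) - 1\<^sub>m k $$ (a, z)"
    using Phi_word_carrier[OF w(2)] Cons.prems by (simp add: CD)
  also have "(\<Sum>l<m. \<Sum>y<k. (\<Sum>c<k. Pw [(i, e)] $$ (a, c) * Ph (fox l w) $$ (c, y)) * ?D l $$ (y, z))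
      = (\<Sum>l<m. \<Sum>c<k. Pw [(i, e)] $$ (a, c) * (\<Sum>y<k. Ph (fox l w) $$ (c, y) * ?D l $$ (y, z)))"
  proof (rule sum.cong)
    fix l
    have "(\<Sum>y<k. (\<Sum>c<k. Pw [(i, e)] $$ (a, c) * Ph (fox l w) $$ (c, y)) * ?D l $$ (y, z))
        = (\<Sum>y<k. \<Sum>c<k. Pw [(i, e)] $$ (a, c) * (Ph (fox l w) $$ (c, y) * ?D l $$ (y, z)))"
      by (simp add: sum_distrib_right mult.assoc)
    also have "\<dots> = (\<Sum>c<k. Pw [(i, e)] $$ (a, c) * (\<Sum>y<k. Ph (fox l w) $$ (c, y) * ?D l $$ (y, z)))"
      by (subst sum.swap) (simp add: sum_distrib_left)
    finally show "(\<Sum>y<k. (\<Sum>c<k. Pw [(i, e)] $$ (a, c) * Ph (fox l w) $$ (c, y)) * ?D l $$ (y, z)) = \<dots>" .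
  qed simp
  also have "\<dots> = (\<Sum>c<k. Pw [(i, e)] $$ (a, c) * (\<Sum>l<m. \<Sum>y<k. Ph (fox l w) $$ (c, y) * ?D l $$ (y, z)))"
    by (subst sum.swap) (simp add: sum_distrib_left)
  also have "\<dots> = (\<Sum>c<k. Pw [(i, e)] $$ (a, c) * (Pw w $$ (c, z) - 1\<^sub>m k $$ (c, z)))"
    using Cons.IH[OF w(1)] Cons.prems by simp
  also have "\<dots> = (Pw [(i, e)] * Pw w) $$ (a, z) - Pw [(i, e)] $$ (a, z)"
    using Phi_word_carrier[OF w(1)] Phi_word_carrier[OF w(2)] Cons.prems
    by (simp add: scalar_prod_def lessThan_atLeast0 right_diff_distrib sum_subtractf if_distrib[of "\<lambda>x. _ * x"] cong: if_cong)
  also have "Pw [(i, e)] * Pw w = Pw (x # w)"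
    using Phi_word_Cons[of x w] Cons.prems by (simp add: x)
  finally show ?case by simp
qed

end

section \<open>Wada quotients of regular representations\<close>

lemma frag_eval_cong:
  assumes "\<And>w. w \<in> Poly_Mapping.keys z \<Longrightarrow> g w = h w"
  shows "frag_eval g z = frag_eval h z"
  using assms by (simp add: frag_eval_def)

lemma sum_frag_eval: "(\<Sum>a\<in>A. frag_eval (g a) z) = frag_eval (\<lambda>w. \<Sum>a\<in>A. g a w) z"
  unfolding frag_eval_def by (subst sum.swap) (simp add: sum_distrib_left)

lemma dim_Phi: "dim_row (Phi GK \<phi> gens k \<rho> z) = k" "dim_col (Phi GK \<phi> gens k \<rho> z) = k"
  by (simp_all add: Phi_def)

section \<open>Change of the generator in Wada's quotient\<close>

text \<open>Skipping \<open>k\<close> columns from position \<open>k * j\<close> on raises the block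
  index by one and keeps the position inside the block.\<close>

lemma remove_block_col_fox_matrix:
  assumes "0 < k" and "j < length gens" and "length gens = length rels + 1"
  shows "remove_block_col k j (fox_matrix GK \<phi> gens rels k \<rho>)
    = mat (k * length rels) (k * length rels) (\<lambda>(a, b).
        Phi GK \<phi> gens k \<rho> (fox (if b div k < j then b div k else b div k + 1) (rels ! (a div k))) $$ (a mod k, b mod k))"
proof (rule eq_matI, goal_cases)
  case (1 a b)
  then have ab: "a < k * length rels" "b < k * length rels" by simp_all
  have "b < k * j \<longleftrightarrow> b div k < j"
    using \<open>0 < k\<close> by (simp add: div_less_iff_less_mult mult.commute)
  moreover have "(b + k) div k = b div k + 1" "(b + k) mod k = b mod k"
    using \<open>0 < k\<close> by simp_all
  moreover have "b + k < k * length gens"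
    using ab by (simp add: assms)
  ultimately show ?case
    using ab assms by (auto simp: remove_block_col_def fox_matrix_def)
qed (simp_all add: remove_block_col_def fox_matrix_def assms)

text \<open>Relators evaluate to the neutral element, so by the fundamental formula their block rows
  are annihilated by the blocks \<open>\<Phi>(s_l - 1)\<close>. This is the relation that
  \<open>det_exchange_column_block\<close> needs; the result is Wada's comparison in
  cross-multiplied form.\<close>

lemma (in matrix_rep) wada_exchange:
  assumes "0 < k" and len: "m = length rels + 1" and "i < m" "j < m"
    and rels: "set rels \<subseteq> words m" "\<And>r. r \<in> set rels \<Longrightarrow> word_eval GK gens r = \<one>"
  shows "\<exists>\<epsilon>. \<epsilon> \<in> {1, - 1} \<and>
    det (remove_block_col k i (fox_matrix GK \<phi> gens rels k \<rho>)) * det (Ph (gen_minus_one j))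
      = \<epsilon> * (det (remove_block_col k j (fox_matrix GK \<phi> gens rels k \<rho>)) * det (Ph (gen_minus_one i)))"
proof -
  define A where "A = (\<lambda>a (l, y). Ph (fox l (rels ! (a div k))) $$ (a mod k, y))"
  define c where "c = (\<lambda>j b. (if b div k < j then b div k else b div k + 1, b mod k))"
  have n: "k * (m - 1) = k * length rels" using len by simp
  have numer: "remove_block_col k l (fox_matrix GK \<phi> gens rels k \<rho>)
      = mat (k * (m - 1)) (k * (m - 1)) (\<lambda>(a, b). A a (c l b))" if "l < m" for l
    unfolding remove_block_col_fox_matrix[OF \<open>0 < k\<close> that len] n A_def c_def by simp
  have denom: "Ph (gen_minus_one l) = mat k k (\<lambda>(y, z). Ph (gen_minus_one l) $$ (y, z))" for l
    by (rule eq_matI) (simp_all add: Phi_def)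
  have "\<exists>\<epsilon>. \<epsilon> \<in> {1, - 1} \<and>
    det (mat (k * (m - 1)) (k * (m - 1)) (\<lambda>(a, b). A a (c i b))) * det (mat k k (\<lambda>(y, z). Ph (gen_minus_one j) $$ (y, z)))
      = \<epsilon> * (det (mat (k * (m - 1)) (k * (m - 1)) (\<lambda>(a, b). A a (c j b))) * det (mat k k (\<lambda>(y, z). Ph (gen_minus_one i) $$ (y, z))))"
  proof (rule det_exchange_column_block)
    fix a z assume "a < k * (m - 1)" "z < k"
    then have "a div k < length rels"
      unfolding n by (simp add: less_mult_imp_div_less mult.commute)
    then have r: "rels ! (a div k) \<in> set rels" by simp
    have "(\<Sum>l<m. \<Sum>y<k. A a (l, y) * Ph (gen_minus_one l) $$ (y, z))
        = Pw (rels ! (a div k)) $$ (a mod k, z) - 1\<^sub>m k $$ (a mod k, z)"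
      unfolding A_def prod.case by (rule fox_fundamental_formula) (use r rels \<open>0 < k\<close> \<open>z < k\<close> in auto)
    then show "(\<Sum>l<m. \<Sum>y<k. A a (l, y) * Ph (gen_minus_one l) $$ (y, z)) = 0"
      using Phi_word_eq_one[OF rels(2)[OF r]] by simp
  qed (use assms(1,3,4) bij_betw_skip_block in \<open>simp_all add: c_def\<close>)
  then show ?thesis
    unfolding numer[OF \<open>i < m\<close>] numer[OF \<open>j < m\<close>] denom[symmetric] .
qed

section \<open>The regular representation and its reduction modulo p\<close>

lemma (in group) regular_rep_one: "finite (carrier G) \<Longrightarrow> regular_rep G \<one> = 1\<^sub>m (order G)"
proof (rule eq_matI, goal_cases)
  case (1 a b)
  then have "a < order G" "b < order G" by simp_all
  moreover have bij: "bij_betw (from_nat_into (carrier G)) {0..<order G} (carrier G)"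
    using bij_betw_from_nat_into_finite[of "carrier G"] 1 by (simp add: order_def lessThan_atLeast0)
  ultimately show ?case
    using bij_betwE[OF bij] bij_betw_imp_inj_on[OF bij] by (auto simp: regular_rep_def inj_on_def)
qed (simp_all add: regular_rep_def)

text \<open>Row \<open>x\<close> of the first factor has its only 1 in column \<open>x g\<close>,
  and row \<open>x g\<close> of the second leads on to \<open>x g h\<close>. Reading rows as sources
  thus keeps the order of the factors.\<close>

lemma (in group) regular_rep_mult:
  assumes "finite (carrier G)" and g: "g \<in> carrier G" and h: "h \<in> carrier G"
  shows "regular_rep G (g \<otimes> h) = regular_rep G g * regular_rep G h"
proof (rule eq_matI, goal_cases)
  case (1 a b)
  let ?e = "from_nat_into (carrier G)"
  have ab: "a < order G" "b < order G" using 1 by (simp_all add: regular_rep_def)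
  have bij: "bij_betw ?e {0..<order G} (carrier G)"
    using bij_betw_from_nat_into_finite[of "carrier G"] assms by (simp add: order_def lessThan_atLeast0)
  have e: "?e c \<in> carrier G" if "c < order G" for c using bij_betwE[OF bij] that by simp
  have "(regular_rep G g * regular_rep G h) $$ (a, b)
      = (\<Sum>c = 0..<order G. (if ?e a \<otimes> g = ?e c then 1 else 0) * (if ?e c \<otimes> h = ?e b then 1 else 0))"
    using ab by (simp add: regular_rep_def scalar_prod_def)
  also have "\<dots> = (\<Sum>x\<in>carrier G. (if ?e a \<otimes> g = x then 1 else 0) * (if x \<otimes> h = ?e b then 1 else 0))"
    by (rule sum.reindex_bij_betw[OF bij])
  also have "\<dots> = (\<Sum>x\<in>carrier G. if ?e a \<otimes> g = x then (if x \<otimes> h = ?e b then 1 else 0) else 0)"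
    by (rule sum.cong) auto
  also have "\<dots> = (if ?e a \<otimes> g \<otimes> h = ?e b then 1 else 0)"
    using assms e[OF ab(1)] by (simp add: sum.delta')
  also have "\<dots> = regular_rep G (g \<otimes> h) $$ (a, b)"
    using ab e[OF ab(1)] g h by (simp add: regular_rep_def m_assoc)
  finally show ?case ..
qed (simp_all add: regular_rep_def)

lemma matrix_rep_regular:
  assumes "group GK" and "group G" and "finite (carrier G)" and "f \<in> hom GK G"
    and "\<phi> \<in> hom GK integer_group" and "set gens \<subseteq> carrier GK"
  shows "matrix_rep GK \<phi> gens (order G) (regular_rep G \<circ> f)"
proof -
  interpret GK: group GK by fact
  interpret G: group G by fact
  show ?thesis
  proof
    show "(regular_rep G \<circ> f) \<one>\<^bsub>GK\<^esub> = 1\<^sub>m (order G)"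
      using hom_one[OF assms(4,1,2)] G.regular_rep_one assms(3) by simp
    show "(regular_rep G \<circ> f) (g \<otimes>\<^bsub>GK\<^esub> h) = (regular_rep G \<circ> f) g * (regular_rep G \<circ> f) h"
      if "g \<in> carrier GK" "h \<in> carrier GK" for g h
      using that hom_mult[OF assms(4)] hom_in_carrier[OF assms(4)] assms(3)
      by (simp add: G.regular_rep_mult)
  qed (use assms in \<open>auto simp: regular_rep_def\<close>)
qed

interpretation laurent_mod: comm_ring_hom "laurent_mod :: int laurent \<Rightarrow> 'p::prime_card mod_ring laurent"
proof
  show "laurent_mod 1 = (1 :: 'p mod_ring laurent)"
    using laurent_mod_single[where 'p='p and a=1 and l=0] by (simp add: single_one)
qed (simp_all add: laurent_mod_add laurent_mod_mult laurent_mod_0)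

lemma laurent_mod_of_int: "laurent_mod (of_int c) = (of_int c :: 'p::prime_card mod_ring laurent)"
  by (induction c rule: int_induct[where k=0]) (simp_all add: laurent_mod.hom_add laurent_mod.hom_minus)

lemma CHAR_mod_ring_laurent: "CHAR('p::prime_card mod_ring laurent) = CARD('p)"
proof (rule CHAR_eqI)
  have *: "(of_nat n :: 'p mod_ring laurent) = 0 \<longleftrightarrow> (of_nat n :: 'p mod_ring) = 0" for n
  proof -
    have 1: "(of_nat n :: 'p mod_ring laurent) = laurent_monom (of_nat n) 0"
      by (simp add: single_of_nat)
    have 2: "laurent_monom c 0 = 0 \<longleftrightarrow> c = 0" for c :: "'p mod_ring"
      by (metis lookup_single_eq single_zero lookup_zero)
    show ?thesis by (simp only: 1 2)
  qed
  show "of_nat CARD('p) = (0 :: 'p mod_ring laurent)"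
    unfolding * by simp
  show "CARD('p) dvd n" if "of_nat n = (0 :: 'p mod_ring laurent)" for n
    using that unfolding * by (simp add: of_nat_0_mod_ring_dvd)
qed

text \<open>The entry of $\Phi(z)$ for the regular representation, with rows and columns indexed by the group
  itself instead of its enumeration.\<close>
definition regular_entry :: "('h, 'b) monoid_scheme \<Rightarrow> ('w \<Rightarrow> 'h) \<Rightarrow> ('w \<Rightarrow> int) \<Rightarrow> ('w \<Rightarrow>\<^sub>0 int) \<Rightarrow> 'h \<Rightarrow> 'h \<Rightarrow> 'r::comm_ring_1 laurent" where
  "regular_entry G F \<psi> z x y = frag_eval (\<lambda>w. if x \<otimes>\<^bsub>G\<^esub> F w = y then laurent_monom 1 (\<psi> w) else 0) z"

lemma laurent_mod_Phi_regular:
  assumes "a < order G" "b < order G"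
  shows "laurent_mod (Phi GK \<phi> gens (order G) (regular_rep G \<circ> f) z $$ (a, b))
    = (regular_entry G (\<lambda>w. f (word_eval GK gens w)) (\<lambda>w. \<phi> (word_eval GK gens w)) z
        (from_nat_into (carrier G) a) (from_nat_into (carrier G) b) :: 'p::prime_card mod_ring laurent)"
  using assms
  by (auto simp: Phi_def Phi_word_def Let_def regular_rep_def regular_entry_def frag_eval_def laurent_mod_sum
      laurent_mod.hom_mult laurent_mod_of_int laurent_mod_single laurent_mod_0 intro!: sum.cong)

text \<open>The family \<open>Z\<close> is left general: Fox derivatives give the numerator of
  Wada's quotient, and \<open>r = 1\<close> gives the denominator. Reduction is a ring homomorphism
  and so commutes with \<open>det\<close>.\<close>

lemma laurent_mod_det_regular_blocks:
  fixes GK :: "('g, 'x) monoid_scheme" and G :: "('h, 'b) monoid_scheme"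
  assumes "finite (carrier G)" and "0 < order G"
  shows "laurent_mod (det (mat (order G * r) (order G * r) (\<lambda>(a, b).
      Phi GK \<phi> gens (order G) (regular_rep G \<circ> f) (Z (a div order G) (b div order G)) $$ (a mod order G, b mod order G))))
    = (det_on ({..<r} \<times> carrier G) (\<lambda>(s, x) (l, y). regular_entry G (\<lambda>w. f (word_eval GK gens w))
        (\<lambda>w. \<phi> (word_eval GK gens w)) (Z s l) x y) :: 'p::prime_card mod_ring laurent)"
proof -
  let ?k = "order G"
  define e where "e = (\<lambda>a. (a div ?k, from_nat_into (carrier G) (a mod ?k)))"
  have bij0: "bij_betw (from_nat_into (carrier G)) {..<?k} (carrier G)"
    using bij_betw_from_nat_into_finite[OF assms(1)] by (simp add: order_def)
  have "bij_betw (\<lambda>a. (a div ?k, a mod ?k)) {0..<?k * r} ({..<r} \<times> {..<?k})"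
  proof (rule bij_betw_byWitness[where f' = "\<lambda>(s, a). ?k * s + a"])
    show "(\<lambda>a. (a div ?k, a mod ?k)) ` {0..<?k * r} \<subseteq> {..<r} \<times> {..<?k}"
      using assms(2) by (auto simp: less_mult_imp_div_less mult.commute)
    show "(\<lambda>(s, a). ?k * s + a) ` ({..<r} \<times> {..<?k}) \<subseteq> {0..<?k * r}"
    proof clarsimp
      fix s a assume "s < r" "a < ?k"
      then have "?k * s + a < ?k * Suc s" by simp
      also have "\<dots> \<le> ?k * r" using \<open>s < r\<close> by (intro mult_le_mono) auto
      finally show "?k * s + a < ?k * r" .
    qed
  qed (use assms(2) in auto)
  from bij_betw_trans[OF this bij_betw_map_prod[OF bij_betw_id[of "{..<r}"] bij0]]
  have bij: "bij_betw e {0..<?k * r} ({..<r} \<times> carrier G)"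
    by (simp add: e_def comp_def)
  show ?thesis
    unfolding det_mat_eq_det_on[OF bij, symmetric] laurent_mod.hom_det[symmetric]
    by (rule arg_cong[of _ _ det], rule eq_matI) (use assms(2) in \<open>auto simp: e_def laurent_mod_Phi_regular\<close>)
qed

section \<open>Passage to the quotient group\<close>

text \<open>Coset representatives identify \<open>G\<close> with pairs of an element of
  \<open>H\<close> and a coset. The regular representation multiplies from the right, so its entries
  are invariant under left multiplication by \<open>H\<close>, and
  \<open>det_on_invariant_p_group\<close> applies to \<open>H\<close>. Summing over \<open>H\<close>
  turns equations in \<open>G\<close> into equations of cosets.\<close>

lemma (in normal) det_regular_entry_quotient:
  fixes Z :: "nat \<Rightarrow> nat \<Rightarrow> ('w \<Rightarrow>\<^sub>0 int)" and \<psi> :: "'w \<Rightarrow> int"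
  assumes "finite (carrier G)" and "card H = p ^ n" and "prime p" and "CHAR('r::comm_ring_1 laurent) = p"
    and F: "\<And>s l w. s < r \<Longrightarrow> l < r \<Longrightarrow> w \<in> Poly_Mapping.keys (Z s l) \<Longrightarrow> F w \<in> carrier G"
  shows "det_on ({..<r} \<times> carrier G) (\<lambda>(s, x) (l, y). regular_entry G F \<psi> (Z s l) x y :: 'r laurent)
    = det_on ({..<r} \<times> carrier (G Mod H)) (\<lambda>(s, C) (l, D). regular_entry (G Mod H) (\<lambda>w. H #> F w) \<psi> (Z s l) C D) ^ p ^ n"
proof -
  let ?K = "G\<lparr>carrier := H\<rparr>" and ?Q = "carrier (G Mod H)" and ?A = "\<lambda>(s, x) (l, y). regular_entry G F \<psi> (Z s l) x y :: 'r laurent"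
  interpret K: group ?K by (rule subgroup_is_group[OF is_group])
  have HG: "h \<in> carrier G" if "h \<in> H" for h using that subset by blast
  have "\<exists>\<sigma>. \<forall>C\<in>?Q. \<sigma> C \<in> carrier G \<and> C = H #> \<sigma> C"
    by (intro bchoice) (auto simp: FactGroup_def RCOSETS_def)
  then obtain \<sigma> where \<sigma>: "\<And>C. C \<in> ?Q \<Longrightarrow> \<sigma> C \<in> carrier G" "\<And>C. C \<in> ?Q \<Longrightarrow> H #> \<sigma> C = C"
    by metis
  have coset_iff: "H #> x = H #> y \<longleftrightarrow> x \<otimes> inv y \<in> H" if "x \<in> carrier G" "y \<in> carrier G" for x y
    using that rcos_module[OF is_group, of y x] repr_independence[of x H y] rcos_self[OF _ is_subgroup, of x] is_subgroup
    by metis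
  \<comment> \<open>The component in \<open>H\<close> comes first, so that translation by
    \<open>H\<close> acts on the first factor, with the pairs of block number and coset as
    \<open>Y\<close>.\<close>
  define E where "E = (\<lambda>(h, (s :: nat, C)). (s, h \<otimes> \<sigma> C))"
  have E: "bij_betw E (H \<times> ({..<r} \<times> ?Q)) ({..<r} \<times> carrier G)"
  proof (rule bij_betw_byWitness[where f' = "\<lambda>(s, x). (x \<otimes> inv (\<sigma> (H #> x)), (s, H #> x))"])
    have coset: "H #> (h \<otimes> \<sigma> C) = C" if "h \<in> H" "C \<in> ?Q" for h C
    proof -
      have "H #> (h \<otimes> \<sigma> C) = H #> \<sigma> C"
        using that \<sigma>(1) HG by (subst coset_iff) (simp_all add: m_assoc)
      then show ?thesis using \<sigma>(2) that by simp
    qed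
    then show "\<forall>a\<in>H \<times> {..<r} \<times> ?Q. (case E a of (s, x) \<Rightarrow> (x \<otimes> inv \<sigma> (H #> x), s, H #> x)) = a"
      using \<sigma>(1) HG by (auto simp: E_def m_assoc)
    show "E ` (H \<times> {..<r} \<times> ?Q) \<subseteq> {..<r} \<times> carrier G"
      using \<sigma>(1) HG by (auto simp: E_def)
    have Q: "H #> x \<in> ?Q" if "x \<in> carrier G" for x
      using that by (auto simp: FactGroup_def RCOSETS_def)
    then show "\<forall>a'\<in>{..<r} \<times> carrier G. E (case a' of (s, x) \<Rightarrow> (x \<otimes> inv \<sigma> (H #> x), s, H #> x)) = a'"
      using \<sigma>(1) by (auto simp: E_def m_assoc)
    have "x \<otimes> inv \<sigma> (H #> x) \<in> H" if "x \<in> carrier G" for x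
      using coset_iff[OF that \<sigma>(1)[OF Q[OF that]]] \<sigma>(2)[OF Q[OF that]] by simp
    then show "(\<lambda>(s, x). (x \<otimes> inv \<sigma> (H #> x), s, H #> x)) ` ({..<r} \<times> carrier G) \<subseteq> H \<times> {..<r} \<times> ?Q"
      using Q by auto
  qed
  have finQ: "finite ?Q"
    using assms(1) by (simp add: FactGroup_def RCOSETS_def)
  have finH: "finite H" using assms(1) subset finite_subset by blast
  have "det_on ({..<r} \<times> carrier G) ?A = det_on (H \<times> ({..<r} \<times> ?Q)) (\<lambda>y z. ?A (E y) (E z))"
    by (rule det_on_reindex[OF E]) (use finQ finH in simp)
  also have "\<dots> = det_on ({..<r} \<times> ?Q) (\<lambda>y y'. \<Sum>h\<in>H. ?A (E (\<one>, y)) (E (h, y'))) ^ p ^ n"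
  proof -
    have inv: "?A (E (g \<otimes> h, y)) (E (g \<otimes> h', y')) = ?A (E (h, y)) (E (h', y'))"
      if "g \<in> H" "h \<in> H" "h' \<in> H" "y \<in> {..<r} \<times> ?Q" "y' \<in> {..<r} \<times> ?Q" for g h h' y y'
    proof -
      obtain s C l D where y: "y = (s, C)" "y' = (l, D)" by (metis surj_pair)
      have "regular_entry G F \<psi> (Z s l) (g \<otimes> h \<otimes> \<sigma> C) (g \<otimes> h' \<otimes> \<sigma> D)
          = (regular_entry G F \<psi> (Z s l) (h \<otimes> \<sigma> C) (h' \<otimes> \<sigma> D) :: 'r laurent)"
        unfolding regular_entry_def
      proof (rule frag_eval_cong)
        fix w assume "w \<in> Poly_Mapping.keys (Z s l)"
        then have "F w \<in> carrier G" using F that(4,5) by (auto simp: y)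
        then have "g \<otimes> h \<otimes> \<sigma> C \<otimes> F w = g \<otimes> h' \<otimes> \<sigma> D \<longleftrightarrow> h \<otimes> \<sigma> C \<otimes> F w = h' \<otimes> \<sigma> D"
          using that \<sigma>(1) HG by (auto simp: y m_assoc)
        then show "(if g \<otimes> h \<otimes> \<sigma> C \<otimes> F w = g \<otimes> h' \<otimes> \<sigma> D then laurent_monom 1 (\<psi> w) else 0)
            = (if h \<otimes> \<sigma> C \<otimes> F w = h' \<otimes> \<sigma> D then laurent_monom 1 (\<psi> w) else 0)"
          by simp
      qed
      then show ?thesis by (simp add: y E_def)
    qed
    show ?thesis
      using K.det_on_invariant_p_group[of p n "{..<r} \<times> ?Q" "\<lambda>y z. ?A (E y) (E z)"] assms(2-4) finQ inv
      by (simp add: order_def)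
  qed
  also have "det_on ({..<r} \<times> ?Q) (\<lambda>y y'. \<Sum>h\<in>H. ?A (E (\<one>, y)) (E (h, y')))
      = det_on ({..<r} \<times> ?Q) (\<lambda>(s, C) (l, D). regular_entry (G Mod H) (\<lambda>w. H #> F w) \<psi> (Z s l) C D)"
  proof (rule det_on_cong)
    fix y y' assume "y \<in> {..<r} \<times> ?Q" "y' \<in> {..<r} \<times> ?Q"
    then obtain s C l D where y: "y = (s, C)" "y' = (l, D)"
      and s: "s \<in> {..<r}" "l \<in> {..<r}" and C: "C \<in> ?Q" "D \<in> ?Q"
      by blast
    have "(\<Sum>h\<in>H. regular_entry G F \<psi> (Z s l) (\<sigma> C) (h \<otimes> \<sigma> D) :: 'r laurent)
        = frag_eval (\<lambda>w. \<Sum>h\<in>H. if \<sigma> C \<otimes> F w = h \<otimes> \<sigma> D then laurent_monom 1 (\<psi> w) else 0) (Z s l)"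
      unfolding regular_entry_def by (rule sum_frag_eval)
    also have "\<dots> = regular_entry (G Mod H) (\<lambda>w. H #> F w) \<psi> (Z s l) C D"
      unfolding regular_entry_def
    proof (rule frag_eval_cong)
      fix w assume "w \<in> Poly_Mapping.keys (Z s l)"
      then have Fw: "F w \<in> carrier G" using F s by auto
      note car = \<sigma>(1)[OF C(1)] \<sigma>(1)[OF C(2)] Fw
      \<comment> \<open>There is only one candidate for \<open>h\<close>, and it lies in
        \<open>H\<close> exactly when \<open>\<sigma> C \<otimes> F w\<close> and
        \<open>\<sigma> D\<close> are in the same coset.\<close>
      have "(\<Sum>h\<in>H. if \<sigma> C \<otimes> F w = h \<otimes> \<sigma> D then laurent_monom 1 (\<psi> w) else 0)
          = (\<Sum>h\<in>H. if h = \<sigma> C \<otimes> F w \<otimes> inv (\<sigma> D) then laurent_monom (1::'r) (\<psi> w) else 0)"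
      proof (rule sum.cong)
        fix h assume "h \<in> H"
        then have "\<sigma> C \<otimes> F w = h \<otimes> \<sigma> D \<longleftrightarrow> h = \<sigma> C \<otimes> F w \<otimes> inv (\<sigma> D)"
          using car HG by (metis inv_solve_right m_closed)
        then show "(if \<sigma> C \<otimes> F w = h \<otimes> \<sigma> D then laurent_monom (1::'r) (\<psi> w) else 0)
            = (if h = \<sigma> C \<otimes> F w \<otimes> inv (\<sigma> D) then laurent_monom 1 (\<psi> w) else 0)" by simp
      qed simp
      also have "\<dots> = (if \<sigma> C \<otimes> F w \<otimes> inv (\<sigma> D) \<in> H then laurent_monom 1 (\<psi> w) else 0)"
        using finH by simp
      also have "\<sigma> C \<otimes> F w \<otimes> inv (\<sigma> D) \<in> H \<longleftrightarrow> C \<otimes>\<^bsub>G Mod H\<^esub> (H #> F w) = D"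
      proof -
        have "C \<otimes>\<^bsub>G Mod H\<^esub> (H #> F w) = (H #> \<sigma> C) <#> (H #> F w)"
          using \<sigma>(2)[OF C(1)] by (simp add: FactGroup_def)
        also have "\<dots> = H #> (\<sigma> C \<otimes> F w)" by (rule rcos_sum) (use car in auto)
        finally show ?thesis
          using coset_iff[of "\<sigma> C \<otimes> F w" "\<sigma> D"] car \<sigma>(2)[OF C(2)] by simp
      qed
      finally show "(\<Sum>h\<in>H. if \<sigma> C \<otimes> F w = h \<otimes> \<sigma> D then laurent_monom (1::'r) (\<psi> w) else 0)
          = (if C \<otimes>\<^bsub>G Mod H\<^esub> (H #> F w) = D then laurent_monom 1 (\<psi> w) else 0)" .
    qed
    finally show "(\<Sum>h\<in>H. ?A (E (\<one>, y)) (E (h, y')))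
        = (case y of (s, C) \<Rightarrow> \<lambda>(l, D). regular_entry (G Mod H) (\<lambda>w. H #> F w) \<psi> (Z s l) C D) y'"
      using \<sigma>(1)[OF C(1)] by (simp add: E_def y)
  qed
  finally show ?thesis .
qed

section \<open>Nonvanishing of the reduced denominators\<close>

text \<open>A vector killed by $t \rho(g) - 1$ satisfies $v_x = t v_{xg}$ and hence $v_x = t^{|G|} v_x$.\<close>
lemma (in group) det_regular_generator_nonzero:
  assumes "finite (carrier G)" and g: "g \<in> carrier G"
    and M: "M = mat (order G) (order G) (\<lambda>(a, b).
      (if from_nat_into (carrier G) a \<otimes> g = from_nat_into (carrier G) b then laurent_monom 1 1 else 0)
      - (if from_nat_into (carrier G) a = from_nat_into (carrier G) b then 1 else 0))"
  shows "det M \<noteq> (0 :: 'r::idom laurent)"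
proof
  let ?k = "order G" and ?e = "from_nat_into (carrier G)" and ?t = "laurent_monom 1 1 :: 'r laurent"
  assume "det M = 0"
  moreover have "M \<in> carrier_mat ?k ?k" by (simp add: M)
  ultimately obtain v where v: "v \<in> carrier_vec ?k" "v \<noteq> 0\<^sub>v ?k" "M *\<^sub>v v = 0\<^sub>v ?k"
    using det_0_iff_vec_prod_zero by blast
  have bij: "bij_betw ?e {0..<?k} (carrier G)"
    using bij_betw_from_nat_into_finite[of "carrier G"] assms by (simp add: order_def lessThan_atLeast0)
  define u where "u = (\<lambda>x. v $ inv_into {0..<?k} ?e x)"
  have u_e: "u (?e a) = v $ a" if "a < ?k" for a
    using bij_betw_inv_into_left[OF bij] that by (simp add: u_def)
  have step: "u x = ?t * u (x \<otimes> g)" if x: "x \<in> carrier G" for x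
  proof -
    obtain a where a: "a < ?k" "x = ?e a"
      using bij_betw_imp_surj_on[OF bij] x by (metis atLeastLessThan_iff imageE)
    have "0 = (M *\<^sub>v v) $ a" using v(3) a by simp
    also have "\<dots> = (\<Sum>b = 0..<?k. ((if x \<otimes> g = ?e b then ?t else 0) - (if x = ?e b then 1 else 0)) * u (?e b))"
      using a v(1) by (auto simp: M scalar_prod_def u_e intro!: sum.cong)
    also have "\<dots> = (\<Sum>y\<in>carrier G. ((if x \<otimes> g = y then ?t else 0) - (if x = y then 1 else 0)) * u y)"
      by (rule sum.reindex_bij_betw[OF bij])
    also have "\<dots> = (\<Sum>y\<in>carrier G. if x \<otimes> g = y then ?t * u y else 0) - (\<Sum>y\<in>carrier G. if x = y then u y else 0)"
      unfolding sum_subtractf[symmetric] by (rule sum.cong) (auto simp: left_diff_distrib)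
    also have "\<dots> = ?t * u (x \<otimes> g) - u x"
      using x g assms(1) by (simp add: sum.delta')
    finally show ?thesis by simp
  qed
  have iter: "u x = ?t ^ l * u (x \<otimes> g [^] l)" if "x \<in> carrier G" for x and l :: nat
  proof (induction l)
    case (Suc l)
    have "u (x \<otimes> g [^] l) = ?t * u (x \<otimes> g [^] l \<otimes> g)"
      by (rule step) (use that g in simp)
    then have "u x = ?t ^ l * (?t * u (x \<otimes> g [^] l \<otimes> g))" using Suc by metis
    also have "\<dots> = ?t ^ Suc l * u (x \<otimes> g [^] Suc l)"
      using that g by (simp only: power_Suc2 nat_pow_Suc m_assoc nat_pow_closed mult.assoc)
    finally show ?case .
  qed (use that in simp)
  have "u x = ?t ^ ?k * u x" if "x \<in> carrier G" for x
    using iter[OF that, of ?k] that by (simp only: pow_order_eq_1[OF g] r_one)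
  moreover have pow: "?t ^ l = laurent_monom 1 (int l)" for l
    by (induction l) (simp_all add: mult_single single_one)
  \<comment> \<open>The order of a finite group is positive, so this monomial has coefficient 0 at
    exponent 0.\<close>
  moreover have "laurent_monom 1 (int ?k) \<noteq> (1 :: 'r laurent)"
  proof
    assume "laurent_monom 1 (int ?k) = (1 :: 'r laurent)"
    then have "Poly_Mapping.lookup (laurent_monom 1 (int ?k)) 0 = Poly_Mapping.lookup (1 :: 'r laurent) 0" by simp
    then show False
      using order_gt_0_iff_finite assms(1) by (simp add: lookup_single when_def lookup_one)
  qed
  ultimately have "u x = 0" if "x \<in> carrier G" for x
    using that by (metis mult_cancel_right1)
  then have "v $ a = 0" if "a < ?k" for a
    using u_e[OF that] bij_betwE[OF bij] that by simp
  then have "v = 0\<^sub>v ?k" using v(1) by (intro eq_vecI) auto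
  then show False using v(2) by simp
qed

text \<open>Since \<phi> is 1 on the generator, the reduced matrix is t times a permutation matrix
  minus the identity. The nonzero determinant is the denominator that \<open>fract_mod_Fract\<close>
  asks for.\<close>

lemma det_Phi_regular_generator_nonzero:
  fixes f :: "'g \<Rightarrow> 'h"
  assumes "group GK" and "group G" and "finite (carrier G)" and "f \<in> hom GK G" and "\<phi> \<in> hom GK integer_group"
    and gens: "set gens \<subseteq> carrier GK" "i < length gens" and "\<phi> (gens ! i) = 1"
  shows "laurent_mod (det (Phi GK \<phi> gens (order G) (regular_rep G \<circ> f) (frag_of [(i, True)] - frag_of [])))
    \<noteq> (0 :: 'p::prime_card mod_ring laurent)"
proof -
  interpret GK: group GK by fact
  interpret G: group G by fact
  let ?k = "order G" and ?e = "from_nat_into (carrier G)"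
  have s: "gens ! i \<in> carrier GK" using gens nth_mem by blast
  then have fs: "f (gens ! i) \<in> carrier G" using hom_in_carrier[OF assms(4)] by simp
  have eval: "word_eval GK gens [(i, True)] = gens ! i" "word_eval GK gens [] = \<one>\<^bsub>GK\<^esub>"
    using s by (simp_all add: word_eval_def letter_eval_def)
  have one: "f \<one>\<^bsub>GK\<^esub> = \<one>\<^bsub>G\<^esub>" "\<phi> \<one>\<^bsub>GK\<^esub> = 0"
    using hom_one[OF assms(4,1,2)] hom_one[OF assms(5,1)] by simp_all
  have "?e a \<in> carrier G" if "a < ?k" for a
    using that by (intro from_nat_into) auto
  then have "map_mat laurent_mod (Phi GK \<phi> gens ?k (regular_rep G \<circ> f) (frag_of [(i, True)] - frag_of []))
    = mat ?k ?k (\<lambda>(a, b). (if ?e a \<otimes>\<^bsub>G\<^esub> f (gens ! i) = ?e b then laurent_monom 1 1 else 0)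
      - (if ?e a = ?e b then 1 else 0 :: 'p mod_ring laurent))"
    by (intro eq_matI)
      (simp_all add: laurent_mod_Phi_regular regular_entry_def frag_eval_diff eval one assms(8) single_one dim_Phi)
  with G.det_regular_generator_nonzero[OF assms(3) fs HOL.refl, where 'r="'p mod_ring"]
  show ?thesis by (metis laurent_mod.hom_det)
qed

section \<open>The congruence of Wada quotients\<close>

text \<open>With the same generator for both representations, numerator and denominator are each a
  determinant of the block form treated in \<open>det_regular_entry_quotient\<close>, so each
  becomes a power separately.\<close>

lemma wada_quotient_mod:
  fixes f :: "'g \<Rightarrow> 'h" and \<phi> :: "'g \<Rightarrow> int"
  assumes "group GK" and "finite (carrier G)" and "H \<lhd> G" and "card H = CARD('p::prime_card) ^ n"
    and "f \<in> hom GK G" and "set gens \<subseteq> carrier GK"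
    and "length gens = length rels + 1" and "i < length gens" and "set rels \<subseteq> words (length gens)"
  defines "numer \<equiv> \<lambda>k \<rho>. laurent_mod (det (remove_block_col k i (fox_matrix GK \<phi> gens rels k \<rho>))) :: 'p mod_ring laurent"
    and "denom \<equiv> \<lambda>k \<rho>. laurent_mod (det (Phi GK \<phi> gens k \<rho> (frag_of [(i, True)] - frag_of []))) :: 'p mod_ring laurent"
  shows "numer (order G) (regular_rep G \<circ> f)
      = numer (order (G Mod H)) (regular_rep (G Mod H) \<circ> (\<lambda>g. H #>\<^bsub>G\<^esub> g) \<circ> f) ^ CARD('p) ^ n"
    and "denom (order G) (regular_rep G \<circ> f)
      = denom (order (G Mod H)) (regular_rep (G Mod H) \<circ> (\<lambda>g. H #>\<^bsub>G\<^esub> g) \<circ> f) ^ CARD('p) ^ n"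
proof -
  interpret GK: group GK by fact
  interpret normal H G by fact
  have finQ: "finite (carrier (G Mod H))"
    using assms(2) by (simp add: FactGroup_def RCOSETS_def)
  have pos: "0 < order G" "0 < order (G Mod H)"
    using assms(2) finQ order_gt_0_iff_finite monoid.order_gt_0_iff_finite[OF group.is_monoid[OF factorgroup_is_group]] by auto
  define B where "B = (\<lambda>k (\<rho> :: 'g \<Rightarrow> int mat) r Z. mat (k * r) (k * r) (\<lambda>(a, b).
      Phi GK \<phi> gens k \<rho> (Z (a div k) (b div k)) $$ (a mod k, b mod k)))"
  have main: "laurent_mod (det (B (order G) (regular_rep G \<circ> f) r Z))
      = (laurent_mod (det (B (order (G Mod H)) (regular_rep (G Mod H) \<circ> ((\<lambda>g. H #>\<^bsub>G\<^esub> g) \<circ> f)) r Z))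
          :: 'p mod_ring laurent) ^ CARD('p) ^ n"
    if Z: "\<And>s l. s < r \<Longrightarrow> l < r \<Longrightarrow> Poly_Mapping.keys (Z s l) \<subseteq> words (length gens)" for r Z
  proof -
    have F: "f (word_eval GK gens w) \<in> carrier G" if "s < r" "l < r" "w \<in> Poly_Mapping.keys (Z s l)" for s l w
    proof -
      have "w \<in> words (length gens)" using Z that by blast
      then have "word_eval GK gens w \<in> carrier GK"
        using assms(6) nth_mem[of _ gens]
        by (induction w) (fastforce simp: word_eval_def words_def letter_eval_def)+
      then show ?thesis using hom_in_carrier[OF assms(5)] by blast
    qed
    show ?thesis
      unfolding B_def laurent_mod_det_regular_blocks[OF assms(2) pos(1)] laurent_mod_det_regular_blocks[OF finQ pos(2)] comp_apply
      by (rule det_regular_entry_quotient[OF assms(2,4) prime_card CHAR_mod_ring_laurent]) (rule F)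
  qed
  \<comment> \<open>The block column of generator \<open>i\<close> is the removed one, so block
    indices from \<open>i\<close> on are shifted.\<close>
  let ?Z = "\<lambda>s l. fox (if l < i then l else l + 1) (rels ! s)"
  have "numer k \<rho> = laurent_mod (det (B k \<rho> (length rels) ?Z))" if "0 < k" for k \<rho>
    unfolding numer_def B_def remove_block_col_fox_matrix[OF that assms(8,7)] ..
  moreover have "Poly_Mapping.keys (?Z s l) \<subseteq> words (length gens)" if "s < length rels" for s l
    using assms(9) that by (intro keys_fox) auto
  ultimately show "numer (order G) (regular_rep G \<circ> f)
      = numer (order (G Mod H)) (regular_rep (G Mod H) \<circ> (\<lambda>g. H #>\<^bsub>G\<^esub> g) \<circ> f) ^ CARD('p) ^ n"
    using main[of "length rels" ?Z] pos by (simp add: comp_assoc)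
  \<comment> \<open>The denominator is the case of a single block.\<close>
  have "B k \<rho> 1 (\<lambda>_ _. z) = Phi GK \<phi> gens k \<rho> z" for k \<rho> z
    by (rule eq_matI) (simp_all add: B_def dim_Phi)
  moreover have "Poly_Mapping.keys (frag_of [(i, True)] - frag_of []) \<subseteq> words (length gens)"
    using keys_diff[of "frag_of [(i, True)]" "frag_of []"] assms(8) by (auto simp: words_def)
  ultimately show "denom (order G) (regular_rep G \<circ> f)
      = denom (order (G Mod H)) (regular_rep (G Mod H) \<circ> (\<lambda>g. H #>\<^bsub>G\<^esub> g) \<circ> f) ^ CARD('p) ^ n"
    using main[of 1 "\<lambda>_ _. frag_of [(i, True)] - frag_of []"] unfolding denom_def by (simp add: comp_assoc)
qed

lemma Fract_power: "b \<noteq> 0 \<Longrightarrow> Fract a b ^ n = Fract (a ^ n) (b ^ n)"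
  by (induction n) (simp_all add: One_fract_def)

text \<open>At the same generator \<open>i\<close> the two representations are compared by
  \<open>wada_quotient_mod\<close>; \<open>wada_exchange\<close> for \<open>G Mod H\<close> then
  leads from \<open>i\<close> to \<open>j\<close> at the cost of a sign. The prime occurs as the
  number \<open>p\<close> and as the size of the type \<open>'p\<close>, over which the field of
  residues is formed.\<close>

theorem theorem1p1:
  fixes c :: "real \<Rightarrow> real^4"
    and \<tau> :: "real \<times> complex \<Rightarrow> real^4"
    and x0 :: "real^4"
    and \<phi> :: "(real \<Rightarrow> real^4) set \<Rightarrow> int"
    and gens :: "(real \<Rightarrow> real^4) set list"
    and rels :: "word list"
    and i j :: nat
    and G :: "('a, 'b) monoid_scheme"
    and H :: "'a set"
    and p n :: nat
    and f :: "(real \<Rightarrow> real^4) set \<Rightarrow> 'a"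
  assumes "oriented_knot c"
    and "tubular_neighborhood c \<tau>"
    and "x0 \<in> knot_exterior \<tau>"
    and "knot_abelianization \<tau> x0 \<phi>"
    and "wirtinger_presentation \<tau> x0 gens rels"
    and "i < length gens" and "j < length gens"
    and "group G" and "finite (carrier G)"
    and "prime p" and "p = CARD('p::prime_card)"
    and "H \<lhd> G" and "card H = p ^ n"
    and "f \<in> epi (knot_group \<tau> x0) G"
  shows "eq_up_to_unit
    (fract_mod (twisted_alexander (knot_group \<tau> x0) \<phi> gens rels i
        (order G) (regular_rep G \<circ> f))
      :: 'p mod_ring laurent fract)
    ((fract_mod (twisted_alexander (knot_group \<tau> x0) \<phi> gens rels j
        (order (G Mod H)) (regular_rep (G Mod H) \<circ> (\<lambda>g. H #>\<^bsub>G\<^esub> g) \<circ> f))) ^ (p ^ n))"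
proof -
  let ?K = "knot_group \<tau> x0" and ?Q = "G Mod H" and ?q = "p ^ n"
  let ?\<rho> = "regular_rep G \<circ> f" and ?\<rho>' = "regular_rep (G Mod H) \<circ> (\<lambda>g. H #>\<^bsub>G\<^esub> g) \<circ> f"
  have K: "group ?K"
    using assms(3) by (rule group_fundamental_group)
  interpret K: group ?K by (rule K)
  interpret normal H G by fact
  have \<phi>: "\<phi> \<in> hom ?K integer_group" and \<phi>_meridian: "\<And>\<mu>. \<mu> \<in> oriented_meridians \<tau> x0 \<Longrightarrow> \<phi> \<mu> = 1"
    using assms(4) by (auto simp: knot_abelianization_def epi_def)
  have f: "f \<in> hom ?K G" using assms(14) by (simp add: epi_def)
  have pres: "is_presentation ?K gens rels" and len: "length gens = length rels + 1"
    and mer: "set gens \<subseteq> oriented_meridians \<tau> x0"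
    using assms(5) by (auto simp: wirtinger_presentation_def)
  have gens: "set gens \<subseteq> carrier ?K" and rels: "set rels \<subseteq> words (length gens)"
    and pres_one: "\<And>w. w \<in> words (length gens) \<Longrightarrow> word_eval ?K gens w = \<one>\<^bsub>?K\<^esub> \<longleftrightarrow> pres_eq (set rels) w []"
    using pres by (auto simp: is_presentation_def)
  have rels_one: "word_eval ?K gens r = \<one>\<^bsub>?K\<^esub>" if "r \<in> set rels" for r
    using pres_one[of r] rels that pres_eq.relator[OF that, of "[]" "[]"] by auto
  have \<phi>_gens: "\<phi> (gens ! l) = 1" if "l < length gens" for l
    using \<phi>_meridian mer nth_mem[OF that] by blast
  have Q: "group ?Q" by (rule factorgroup_is_group)
  have finQ: "finite (carrier ?Q)"
    using assms(9) by (simp add: FactGroup_def RCOSETS_def)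
  have posQ: "0 < order ?Q"
    using finQ monoid.order_gt_0_iff_finite[OF group.is_monoid[OF Q]] by simp
  have \<pi>f: "(\<lambda>g. H #>\<^bsub>G\<^esub> g) \<circ> f \<in> hom ?K ?Q"
    using f r_coset_hom_Mod by (rule Group.hom_compose)
  interpret rep: matrix_rep ?K \<phi> gens "order ?Q" ?\<rho>'
    using matrix_rep_regular[OF K Q finQ \<pi>f \<phi> gens] by (simp add: comp_assoc)
  define N D where "N = (\<lambda>l. det (remove_block_col (order ?Q) l (fox_matrix ?K \<phi> gens rels (order ?Q) ?\<rho>')))"
    and "D = (\<lambda>l. det (Phi ?K \<phi> gens (order ?Q) ?\<rho>' (frag_of [(l, True)] - frag_of [])))"
  define N' D' where "N' = det (remove_block_col (order G) i (fox_matrix ?K \<phi> gens rels (order G) ?\<rho>))"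
    and "D' = det (Phi ?K \<phi> gens (order G) ?\<rho> (frag_of [(i, True)] - frag_of []))"
  let ?m = "laurent_mod :: int laurent \<Rightarrow> 'p mod_ring laurent"
  have N': "?m N' = ?m (N i) ^ ?q" and D': "?m D' = ?m (D i) ^ ?q"
    using wada_quotient_mod[where 'p='p, OF K assms(9,12) _ f gens len assms(6) rels, of n \<phi>] assms(11,13)
    by (simp_all add: N_def D_def N'_def D'_def)
  have D: "?m (D l) \<noteq> 0" if "l < length gens" for l
    using det_Phi_regular_generator_nonzero[OF K Q finQ \<pi>f \<phi> gens that \<phi>_gens[OF that], where 'p='p]
    by (simp add: D_def comp_assoc)
  obtain \<epsilon> where \<epsilon>: "\<epsilon> \<in> {1, - 1}" "N i * D j = \<epsilon> * (N j * D i)"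
    using rep.wada_exchange[OF posQ len assms(6,7) rels rels_one] unfolding N_def D_def by blast
  \<comment> \<open>The sign \<epsilon> raised to the power \<open>p ^ n\<close>, read as a nonzero
    residue; it is the unit of the conclusion, with exponent 0 of t.\<close>
  define \<delta> :: "'p mod_ring" where "\<delta> = (if \<epsilon> ^ ?q = 1 then 1 else - 1)"
  have "\<epsilon> ^ ?q \<in> {1, - 1}" using \<epsilon>(1) by (cases "even ?q") auto
  then have \<delta>: "?m (\<epsilon> ^ ?q) = laurent_monom \<delta> 0"
    by (auto simp: \<delta>_def laurent_mod.hom_uminus single_one single_uminus)
  have "?m (N i) ^ ?q * ?m (D j) ^ ?q = ?m ((N i * D j) ^ ?q)"
    by (simp add: laurent_mod.hom_power laurent_mod.hom_mult power_mult_distrib)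
  also have "\<dots> = laurent_monom \<delta> 0 * ?m (N j) ^ ?q * ?m (D i) ^ ?q"
    unfolding \<epsilon>(2) \<delta>[symmetric] by (simp add: laurent_mod.hom_power laurent_mod.hom_mult power_mult_distrib mult.assoc)
  finally have cross: "?m (N i) ^ ?q * ?m (D j) ^ ?q = laurent_monom \<delta> 0 * ?m (N j) ^ ?q * ?m (D i) ^ ?q" .
  \<comment> \<open>The denominator for \<open>G\<close> reduces to a power of the nonzero
    \<open>?m (D i)\<close>, so \<open>fract_mod\<close> is computed on this representation of the
    fraction.\<close>
  have "fract_mod (twisted_alexander ?K \<phi> gens rels i (order G) ?\<rho>) = Fract (?m N') (?m D')"
    unfolding twisted_alexander_def N'_def[symmetric] D'_def[symmetric]
    by (rule fract_mod_Fract) (use D[OF assms(6)] D' in simp)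
  moreover have "fract_mod (twisted_alexander ?K \<phi> gens rels j (order ?Q) ?\<rho>') = Fract (?m (N j)) (?m (D j))"
    using fract_mod_Fract[OF D[OF assms(7)]] by (simp add: twisted_alexander_def N_def D_def)
  moreover have "Fract (?m N') (?m D') = Fract (laurent_monom \<delta> 0) 1 * Fract (?m (N j)) (?m (D j)) ^ ?q"
    using D[OF assms(6)] D[OF assms(7)] cross by (simp add: N' D' Fract_power eq_fract)
  ultimately show ?thesis
    unfolding eq_up_to_unit_def
    by (intro exI[of _ \<delta>] exI[of _ 0]) (simp add: \<delta>_def)
qed

end
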